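(* Let $c$ be an even positive integer and $n\ge1$. Then $$\bar d_n^{(c)}(q):=\sum_{\alpha\in D_n^{(c)}}(-1)^{L(\alpha)}q^{fmaj(\alpha)}=[c]_q[2c]_q\cdots[nc]_q\sum_{k=0}^n\frac{(-1)^kq^{c\binom{k}{2}}}{[c]_q[2c]_q\cdots[kc]_q}\left(\frac{1-q}{1+q}\right)^{\lfloor\frac{n-k+1}{2}\rfloor}.$$
   Context: $G_{c,n}$ is the set of colored permutations $\pi=\pi_1^{[t_1]}\cdots\pi_n^{[t_n]}$ with $|\pi|=\pi_1\cdots\pi_n$ a permutation of $[n]$ and colors $t_i\in\{0,\dots,c-1\}$; $col(\pi)=\sum_it_i$; $inv(\sigma)$ counts pairs $i<j$ with $\sigma_i>\sigma_j$. The length is $L(\pi)=col(\pi)+c\sum_{j:t_j\ne0}|\{i<j:\pi_i<\pi_j\}|+inv(|\pi|)$. A fixed point of $\pi$ is an index $i$ with $\pi_i=i$ and $t_i=0$; $D_n^{(c)}$ is the set of $\pi\in G_{c,n}$ with no fixed point. Order colored letters by $1^{[c-1]}<\cdots<n^{[c-1]}<\cdots<1^{[1]}<\cdots<n^{[1]}<1<\cdots<n$; $Des_c(\pi)=\{i\in[n-1]:\pi_i^{[t_i]}>\pi_{i+1}^{[t_{i+1}]}\}$, $maj(\pi)=\sum_{i\in Des_c(\pi)}i$, $fmaj(\pi)=c\cdot maj(\pi)+col(\pi)$. $[m]_q=1+q+\cdots+q^{m-1}$; empty products equal $1$. *)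

theory Defs
  imports
    "HOL-Library.FuncSet"
    "HOL-Combinatorics.Permutations"
    "HOL-Computational_Algebra.Polynomial_Factorial"
begin

text \<open>
  A colored permutation is a pair \<open>(p, t)\<close>: \<open>p\<close> is the underlying permutation of \<open>{1..n}\<close> and
  \<open>t i\<close> is the color of the letter \<open>p i\<close>. Both components have fixed values outside \<open>{1..n}\<close>
  (identity and \<open>undefined\<close>), so distinct pairs are distinct colored permutations.
\<close>

type_synonym cperm = "(nat \<Rightarrow> nat) \<times> (nat \<Rightarrow> nat)"

definition colored_perms :: "nat \<Rightarrow> nat \<Rightarrow> cperm set" where
  "colored_perms c n = {p. p permutes {1..n}} \<times> ({1..n} \<rightarrow>\<^sub>E {..<c})"

definition col :: "nat \<Rightarrow> cperm \<Rightarrow> nat" where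
  "col n = (\<lambda>(p, t). \<Sum>i\<in>{1..n}. t i)"

definition inv_count :: "nat \<Rightarrow> (nat \<Rightarrow> nat) \<Rightarrow> nat" where
  "inv_count n p = card {(i, j). i \<in> {1..n} \<and> j \<in> {1..n} \<and> i < j \<and> p i > p j}"

definition clength :: "nat \<Rightarrow> nat \<Rightarrow> cperm \<Rightarrow> nat" where
  "clength c n = (\<lambda>(p, t). col n (p, t)
     + c * (\<Sum>j\<in>{j\<in>{1..n}. t j \<noteq> 0}. card {i\<in>{1..n}. i < j \<and> p i < p j})
     + inv_count n p)"

definition fixed_points :: "nat \<Rightarrow> cperm \<Rightarrow> nat set" where
  "fixed_points n = (\<lambda>(p, t). {i\<in>{1..n}. p i = i \<and> t i = 0})"

definition derangements :: "nat \<Rightarrow> nat \<Rightarrow> cperm set" where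
  "derangements c n = {\<alpha> \<in> colored_perms c n. fixed_points n \<alpha> = {}}"

text \<open>The letter \<open>a\<close> with color \<open>s\<close> is the pair \<open>(a, s)\<close>; a higher color makes a letter smaller.\<close>

definition letter_less :: "nat \<times> nat \<Rightarrow> nat \<times> nat \<Rightarrow> bool" where
  "letter_less = (\<lambda>(a, s) (b, t). s > t \<or> (s = t \<and> a < b))"

definition Des :: "nat \<Rightarrow> cperm \<Rightarrow> nat set" where
  "Des n = (\<lambda>(p, t). {i. 1 \<le> i \<and> i < n \<and> letter_less (p (i + 1), t (i + 1)) (p i, t i)})"

definition maj :: "nat \<Rightarrow> cperm \<Rightarrow> nat" where
  "maj n \<alpha> = (\<Sum>i\<in>Des n \<alpha>. i)"

definition fmaj :: "nat \<Rightarrow> nat \<Rightarrow> cperm \<Rightarrow> nat" where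
  "fmaj c n \<alpha> = c * maj n \<alpha> + col n \<alpha>"

definition signed_derangement_poly :: "nat \<Rightarrow> nat \<Rightarrow> 'a::comm_ring_1 \<Rightarrow> 'a" where
  "signed_derangement_poly c n q =
     (\<Sum>\<alpha>\<in>derangements c n. (- 1) ^ clength c n \<alpha> * q ^ fmaj c n \<alpha>)"

definition qint :: "nat \<Rightarrow> 'a::comm_ring_1 \<Rightarrow> 'a" where
  "qint m q = (\<Sum>i<m. q ^ i)"

definition qprod :: "nat \<Rightarrow> nat \<Rightarrow> 'a::comm_ring_1 \<Rightarrow> 'a" where
  "qprod c k q = (\<Prod>i=1..k. qint (i * c) q)"

text \<open>The indeterminate, as an element of the field of rational functions \<open>Frac(\<int>[q])\<close>.\<close>

definition qvar :: "int poly fract" where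
  "qvar = to_fract [:0, 1:]"

end

theory Submission
  imports Defs "HOL-Computational_Algebra.Formal_Power_Series"
begin

text \<open>
  Since \<open>c\<close> is even, the sign of the length is the sign of \<open>col + inv\<close>. Removing the fixed points of a
  colored permutation leaves \<open>col\<close> and the sign of the underlying permutation unchanged. Next to a
  fixed point, a colored or subcedant letter is small and an uncolored excedant is large, whatever
  the relabelling, so the descents of the permutations with derangement part \<open>\<alpha>\<close> are those of the
  shuffles of \<open>\<alpha>\<close> with an increasing word. Hence the signed sum over all colored permutations is the
  convolution of the signed derangement sums with \<open>q\<^sup>c\<close>-binomial coefficients, which is inverted by the
  \<open>q\<close>-binomial theorem. The signed sum over all colored permutations is the product of the
  \<open>[i c]\<close> evaluated at \<open>(- 1)\<^sup>i q\<close>; this follows by refining according to the last letter.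
\<close>

section \<open>Signed sums over all colored permutations\<close>

text \<open>
  \<open>insert_shift n a \<circ> p\<close> is the word \<open>p\<^sub>1 \<dots> p\<^sub>n a\<close> with the letters \<open>p\<^sub>i \<ge> a\<close> raised by one.
\<close>

definition insert_shift :: "nat \<Rightarrow> nat \<Rightarrow> nat \<Rightarrow> nat" where
  "insert_shift n a x = (if x = Suc n then a else if a \<le> x \<and> x \<le> n then Suc x else x)"

lemma insert_shift_last [simp]: "insert_shift n a (Suc n) = a"
  by (simp add: insert_shift_def)

lemma insert_shift_self: "insert_shift n (Suc n) = id"
  by (auto simp: insert_shift_def fun_eq_iff)

lemma insert_shift_less_iff:
  "x \<le> n \<Longrightarrow> y \<le> n \<Longrightarrow> insert_shift n a x < insert_shift n a y \<longleftrightarrow> x < y"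
  by (auto simp: insert_shift_def)

lemma less_insert_shift_iff: "x \<le> n \<Longrightarrow> a < insert_shift n a x \<longleftrightarrow> a \<le> x"
  by (auto simp: insert_shift_def)

lemma insert_shift_transpose:
  "a \<le> n \<Longrightarrow> insert_shift n a = transpose a (Suc a) \<circ> insert_shift n (Suc a)"
  by (auto simp: insert_shift_def fun_eq_iff transpose_def)

text \<open>The induction runs downward from \<open>a = Suc n\<close>, where the map is the
  identity; each decrease of \<open>a\<close> composes with one adjacent transposition and flips the
  sign. Both claims go together because \<open>sign_compose\<close> needs permutations.\<close>

lemma insert_shift_permutes_sign:
  assumes "1 \<le> a" "a \<le> Suc n"
  shows "insert_shift n a permutes {1..Suc n} \<and> sign (insert_shift n a) = (-1) ^ (Suc n - a)"
  using assms(2,1)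
proof (induction a rule: inc_induct)
  case base
  then show ?case by (simp add: insert_shift_self permutes_def)
next
  case (step a)
  have tr: "transpose a (Suc a) permutes {1..Suc n}"
    using step by (intro permutes_swap_id) auto
  have "permutation (insert_shift n (Suc a))"
    using step by (auto intro: permutes_imp_permutation[of "{1..Suc n}"])
  then have "sign (insert_shift n a) = sign (transpose a (Suc a)) * sign (insert_shift n (Suc a))"
    using step by (simp add: insert_shift_transpose sign_compose permutation_swap_id)
  moreover have "Suc n - a = Suc (Suc n - Suc a)"
    using step by simp
  ultimately have "sign (insert_shift n a) = (-1) ^ (Suc n - a)"
    using step by (simp add: sign_swap_id)
  moreover have "insert_shift n a permutes {1..Suc n}"
    using step by (subst insert_shift_transpose) (use tr in \<open>auto intro: permutes_compose\<close>)
  ultimately show ?case by blast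
qed

lemmas insert_shift_permutes = insert_shift_permutes_sign[THEN conjunct1]
  and sign_insert_shift = insert_shift_permutes_sign[THEN conjunct2]

text \<open>Since \<open>p\<close> fixes \<open>Suc n\<close>, the letter \<open>a\<close> can be
  read off there; undoing the raise then recovers \<open>p\<close>.\<close>

lemma bij_betw_append_letter:
  "bij_betw (\<lambda>(a, p). insert_shift n a \<circ> p) ({1..Suc n} \<times> {p. p permutes {1..n}})
     {p. p permutes {1..Suc n}}"
proof (rule bij_betw_byWitness[where f' = "\<lambda>p. (p (Suc n), inv (insert_shift n (p (Suc n))) \<circ> p)"])
  have "p (Suc n) \<in> {1..Suc n}" if "p permutes {1..Suc n}" for p
    using permutes_in_image[OF that] by simp
  then have shift: "insert_shift n (p (Suc n)) permutes {1..Suc n}" if "p permutes {1..Suc n}" for p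
    using that by (intro insert_shift_permutes) auto
  have "(insert_shift n a \<circ> p) (Suc n) = a \<and> inv (insert_shift n a) \<circ> (insert_shift n a \<circ> p) = p"
    if "a \<in> {1..Suc n}" "p permutes {1..n}" for a p
  proof -
    have "inv (insert_shift n a) \<circ> insert_shift n a = id"
      using that by (intro permutes_inv_o[of _ "{1..Suc n}"] insert_shift_permutes) auto
    with that show ?thesis
      by (simp add: o_assoc permutes_not_in)
  qed
  then show "\<forall>x\<in>{1..Suc n} \<times> {p. p permutes {1..n}}.
      (\<lambda>p. (p (Suc n), inv (insert_shift n (p (Suc n))) \<circ> p)) ((\<lambda>(a, p). insert_shift n a \<circ> p) x) = x"
    by (simp add: Ball_def del: o_apply)
  show "\<forall>p\<in>{p. p permutes {1..Suc n}}.
      (\<lambda>(a, p). insert_shift n a \<circ> p) (p (Suc n), inv (insert_shift n (p (Suc n))) \<circ> p) = p"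
    using permutes_inv_o(1)[OF shift] by (simp add: o_assoc)
  have "insert_shift n a \<circ> p permutes {1..Suc n}"
    if "a \<in> {1..Suc n}" "p permutes {1..n}" for a p
    using that by (intro permutes_compose[of p] insert_shift_permutes permutes_subset[OF that(2)]) auto
  then show "(\<lambda>(a, p). insert_shift n a \<circ> p) ` ({1..Suc n} \<times> {p. p permutes {1..n}})
      \<subseteq> {p. p permutes {1..Suc n}}"
    by (simp add: image_subset_iff)
  have "p (Suc n) \<in> {1..Suc n} \<and> inv (insert_shift n (p (Suc n))) \<circ> p permutes {1..n}"
    if p: "p permutes {1..Suc n}" for p
  proof -
    let ?s = "insert_shift n (p (Suc n))"
    \<comment> \<open>Hence \<open>inv ?s \<circ> p\<close> fixes \<open>Suc n\<close> and permutes
      \<open>{1..n}\<close>.\<close>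
    have "inv ?s (p (Suc n)) = Suc n"
      using permutes_inverses(2)[OF shift[OF p], of "Suc n"] by simp
    then have "inv ?s \<circ> p permutes {1..n}"
      by (intro permutes_superset[OF permutes_compose[OF p permutes_inv[OF shift[OF p]]]])
        (auto simp: le_Suc_eq)
    with permutes_in_image[OF p, of "Suc n"] show ?thesis by simp
  qed
  then show "(\<lambda>p. (p (Suc n), inv (insert_shift n (p (Suc n))) \<circ> p)) ` {p. p permutes {1..Suc n}}
      \<subseteq> {1..Suc n} \<times> {p. p permutes {1..n}}"
    by (simp add: image_subset_iff)
qed

text \<open>Raising letters keeps their relative order, so all new inversions end at position
  \<open>Suc n\<close>; one comes from each of the values \<open>a, ..., n\<close>.\<close>

lemma inv_count_append_letter:
  assumes "p permutes {1..n}" "1 \<le> a" "a \<le> Suc n"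
  shows "inv_count (Suc n) (insert_shift n a \<circ> p) = inv_count n p + (Suc n - a)"
proof -
  have p: "p i \<in> {1..n} \<longleftrightarrow> i \<in> {1..n}" for i
    by (rule permutes_in_image[OF assms(1)])
  have pn: "p (Suc n) = Suc n"
    using assms(1) by (simp add: permutes_not_in)
  have 1: "{(i, j). i \<in> {1..Suc n} \<and> j \<in> {1..Suc n} \<and> i < j \<and>
      (insert_shift n a \<circ> p) i > (insert_shift n a \<circ> p) j} =
    {(i, j). i \<in> {1..n} \<and> j \<in> {1..n} \<and> i < j \<and> p i > p j} \<union>
      (\<lambda>i. (i, Suc n)) ` {i \<in> {1..n}. a \<le> p i}" (is "?L = ?A \<union> ?B")
  proof (intro set_eqI, clarify)
    fix i j
    show "(i, j) \<in> ?L \<longleftrightarrow> (i, j) \<in> ?A \<union> ?B"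
      using p[of i] p[of j] insert_shift_less_iff[of "p j" n "p i" a] less_insert_shift_iff[of "p i" n a] pn
      by (cases "j = Suc n") (auto simp: le_Suc_eq)
  qed
  have "bij_betw p {i \<in> {1..n}. a \<le> p i} {a..n}"
  proof (rule bij_betw_imageI)
    show "inj_on p {i \<in> {1..n}. a \<le> p i}"
      using permutes_inj[OF assms(1)] by (rule inj_on_subset) auto
    show "p ` {i \<in> {1..n}. a \<le> p i} = {a..n}"
    proof
      show "p ` {i \<in> {1..n}. a \<le> p i} \<subseteq> {a..n}"
        using p[THEN iffD2] by fastforce
      show "{a..n} \<subseteq> p ` {i \<in> {1..n}. a \<le> p i}"
      proof
        fix y assume "y \<in> {a..n}"
        moreover from this have "y \<in> p ` {1..n}"
          using assms by (simp add: permutes_image)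
        ultimately show "y \<in> p ` {i \<in> {1..n}. a \<le> p i}" by auto
      qed
    qed
  qed
  then have 2: "card {i \<in> {1..n}. a \<le> p i} = Suc n - a"
    by (simp add: bij_betw_same_card)
  have "finite ?A"
    by (rule finite_subset[of _ "{1..n} \<times> {1..n}"]) auto
  then show ?thesis
    unfolding inv_count_def 1
    by (subst card_Un_disjoint) (use 2 in \<open>auto simp: card_image inj_on_def\<close>)
qed

text \<open>Splitting off the last letter multiplies both sides by
  \<open>(-1) ^ (Suc n - a)\<close>.\<close>

lemma sign_eq_inv_count: "p permutes {1..n} \<Longrightarrow> sign p = (-1) ^ inv_count n p"
proof (induction n arbitrary: p)
  case 0
  then show ?case by (simp add: inv_count_def)
next
  case (Suc n)
  have "p \<in> (\<lambda>(a, p). insert_shift n a \<circ> p) ` ({1..Suc n} \<times> {p. p permutes {1..n}})"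
    unfolding bij_betw_imp_surj_on[OF bij_betw_append_letter] using Suc.prems by blast
  then obtain a r where ar: "a \<in> {1..Suc n}" "r permutes {1..n}" and p: "p = insert_shift n a \<circ> r"
    by (elim imageE SigmaE) auto
  have "sign p = sign (insert_shift n a) * sign r"
    unfolding p using ar insert_shift_permutes[of a n]
    by (intro sign_compose) (auto intro: permutes_imp_permutation[of "{1..Suc n}"] permutes_imp_permutation[of "{1..n}"])
  also have "\<dots> = (-1) ^ (Suc n - a) * (-1) ^ inv_count n r"
    using ar Suc.IH[OF ar(2)] by (simp add: sign_insert_shift)
  finally show ?case
    using inv_count_append_letter[OF ar(2), of a] ar unfolding p by (simp only: power_add mult.commute atLeastAtMost_iff)
qed

section \<open>Appending a colored last letter\<close>

definition append_colored :: "nat \<Rightarrow> nat \<Rightarrow> nat \<Rightarrow> cperm \<Rightarrow> cperm" where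
  "append_colored n a t = (\<lambda>(p, \<tau>). (insert_shift n a \<circ> p, \<tau>(Suc n := t)))"

lemma bij_betw_append_color:
  "bij_betw (\<lambda>(t, \<tau>). \<tau>(Suc n := t)) ({..<c} \<times> ({1..n} \<rightarrow>\<^sub>E {..<c})) ({1..Suc n} \<rightarrow>\<^sub>E {..<c})"
proof (rule bij_betw_imageI)
  show "inj_on (\<lambda>(t, \<tau>). \<tau>(Suc n := t)) ({..<c} \<times> ({1..n} \<rightarrow>\<^sub>E {..<c}))"
    by (rule inj_combinator) simp
  show "(\<lambda>(t, \<tau>). \<tau>(Suc n := t)) ` ({..<c} \<times> ({1..n} \<rightarrow>\<^sub>E {..<c})) = {1..Suc n} \<rightarrow>\<^sub>E {..<c}"
    using PiE_insert_eq[of "Suc n" "{1..n}" "\<lambda>_. {..<c}"]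
    by (simp add: atLeastAtMostSuc_conv)
qed

lemma bij_betw_append_colored:
  "bij_betw (\<lambda>((a, t), x). append_colored n a t x)
     (({1..Suc n} \<times> {..<c}) \<times> colored_perms c n) (colored_perms c (Suc n))"
proof -
  have 1: "bij_betw (map_prod (\<lambda>(a, p). insert_shift n a \<circ> p) (\<lambda>(t, \<tau>). \<tau>(Suc n := t)))
     (({1..Suc n} \<times> {p. p permutes {1..n}}) \<times> ({..<c} \<times> ({1..n} \<rightarrow>\<^sub>E {..<c})))
     (colored_perms c (Suc n))"
    unfolding colored_perms_def
    by (intro bij_betw_map_prod bij_betw_append_letter bij_betw_append_color)
  have 2: "bij_betw (\<lambda>((a, t), (p, \<tau>)). ((a, p), (t, \<tau>)))
     (({1..Suc n} \<times> {..<c}) \<times> colored_perms c n)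
     (({1..Suc n} \<times> {p. p permutes {1..n}}) \<times> ({..<c} \<times> ({1..n} \<rightarrow>\<^sub>E {..<c})))"
    unfolding colored_perms_def
    by (rule bij_betw_byWitness[where f' = "\<lambda>((a, p), (t, \<tau>)). ((a, t), (p, \<tau>))"]) auto
  have "map_prod (\<lambda>(a, p). insert_shift n a \<circ> p) (\<lambda>(t, \<tau>). \<tau>(Suc n := t)) \<circ>
      (\<lambda>((a, t), (p, \<tau>)). ((a, p), (t, \<tau>))) = (\<lambda>((a, t), x). append_colored n a t x)"
    by (auto simp: append_colored_def fun_eq_iff)
  with bij_betw_trans[OF 2 1] show ?thesis by simp
qed

lemma finite_colored_perms: "finite (colored_perms c n)"
  by (simp add: colored_perms_def finite_permutations finite_PiE)

text \<open>The term of \<open>clength\<close> that is a multiple of \<open>c\<close> is left out: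
  for even \<open>c\<close> it does not affect the sign, and the parity of what remains is easy to
  follow when a letter is appended or fixed points are inserted.\<close>

definition signed_weight :: "nat \<Rightarrow> nat \<Rightarrow> 'a::comm_ring_1 \<Rightarrow> cperm \<Rightarrow> 'a" where
  "signed_weight c n q x = (- 1) ^ (col n x + inv_count n (fst x)) * q ^ fmaj c n x"

text \<open>Raising is monotone, so earlier descents persist and position \<open>n\<close> is the
  only new candidate. The condition is \<open>a \<le> p n\<close>, not strict, because a letter
  equal to \<open>a\<close> is itself raised above it.\<close>

lemma Des_append_colored:
  assumes "(p, \<tau>) \<in> colored_perms c n"
  shows "Des (Suc n) (append_colored n a t (p, \<tau>)) = Des n (p, \<tau>) \<union>
    (if n \<ge> 1 \<and> (\<tau> n < t \<or> \<tau> n = t \<and> a \<le> p n) then {n} else {})"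
proof -
  have p: "p permutes {1..n}"
    using assms by (simp add: colored_perms_def)
  have le: "p i \<le> n" if "i \<le> n" for i
    using permutes_in_image[OF p, of i] permutes_not_in[OF p, of i] that by (cases "i \<in> {1..n}") auto
  have last: "p (Suc n) = Suc n"
    using p by (simp add: permutes_not_in)
  have "i \<in> Des (Suc n) (append_colored n a t (p, \<tau>)) \<longleftrightarrow>
      i \<in> Des n (p, \<tau>) \<union> (if n \<ge> 1 \<and> (\<tau> n < t \<or> \<tau> n = t \<and> a \<le> p n) then {n} else {})" for i
  proof (cases "i < n")
    case True
    then show ?thesis
      using le[of i] le[of "Suc i"]
      by (auto simp: Des_def append_colored_def letter_less_def insert_shift_less_iff)
  next
    case False
    then show ?thesis
      using le[of n]
      by (auto simp: Des_def append_colored_def letter_less_def less_insert_shift_iff last)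
  qed
  then show ?thesis by blast
qed

lemma finite_Des: "finite (Des n x)"
  by (rule finite_subset[of _ "{..n}"]) (auto simp: Des_def split: prod.splits)

text \<open>The guard \<open>n \<ge> 1\<close> disappears, since for \<open>n = 0\<close> the added
  summand is 0.\<close>

lemma maj_append_colored:
  assumes "(p, \<tau>) \<in> colored_perms c n"
  shows "maj (Suc n) (append_colored n a t (p, \<tau>)) =
    maj n (p, \<tau>) + (if \<tau> n < t \<or> \<tau> n = t \<and> a \<le> p n then n else 0)"
proof -
  have "n \<notin> Des n (p, \<tau>)" by (simp add: Des_def)
  then show ?thesis
    unfolding maj_def Des_append_colored[OF assms] by (auto simp: finite_Des)
qed

lemma signed_weight_append_colored:
  assumes "(p, \<tau>) \<in> colored_perms c n" "1 \<le> a" "a \<le> Suc n"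
  shows "signed_weight c (Suc n) q (append_colored n a t (p, \<tau>)) =
    (- q) ^ t * (- 1) ^ (Suc n - a) * (signed_weight c n q (p, \<tau>) *
      (if \<tau> n < t \<or> \<tau> n = t \<and> a \<le> p n then q ^ (c * n) else 1))"
proof -
  have p: "p permutes {1..n}"
    using assms by (simp add: colored_perms_def)
  have col: "col (Suc n) (append_colored n a t (p, \<tau>)) = col n (p, \<tau>) + t"
    by (simp add: col_def append_colored_def)
  have inv: "inv_count (Suc n) (fst (append_colored n a t (p, \<tau>))) = inv_count n p + (Suc n - a)"
    using inv_count_append_letter[OF p assms(2,3)] by (simp add: append_colored_def)
  show ?thesis
    unfolding signed_weight_def fmaj_def col inv maj_append_colored[OF assms(1)]
    by (simp add: power_add distrib_left power_minus[of q] mult_ac)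
qed

section \<open>Summation by the last letter\<close>

lemma cyclic_shift_geometric_sum:
  fixes r :: "'a::comm_ring_1"
  assumes "J \<le> N"
  shows "(\<Sum>j<N. r ^ j * (if j < J then r ^ N else 1)) = r ^ J * qint N r"
proof -
  have "(\<Sum>j<N. r ^ j * (if j < J then r ^ N else 1)) =
      (\<Sum>j<J. r ^ (j + N)) + (\<Sum>j\<in>{J..<N}. r ^ j)"
  proof -
    have "{..<N} = {..<J} \<union> {J..<N}" using assms by auto
    then show ?thesis
      by (simp add: sum.union_disjoint ivl_disj_int power_add)
  qed
  \<comment> \<open>The \<open>J\<close> multiplied terms now have the exponents from
    \<open>N\<close> to \<open>N + J - 1\<close> and continue the progression that starts at
    \<open>J\<close>.\<close>
  also have "\<dots> = (\<Sum>j\<in>{N..<J + N}. r ^ j) + (\<Sum>j\<in>{J..<N}. r ^ j)"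
    using sum.shift_bounds_nat_ivl[of "\<lambda>j. r ^ j" 0 N J] by (simp add: atLeast0LessThan)
  also have "\<dots> = (\<Sum>j\<in>{J..<J + N}. r ^ j)"
    using sum.atLeastLessThan_concat[of J N "J + N" "\<lambda>j. r ^ j"] assms by (simp add: add.commute)
  also have "\<dots> = (\<Sum>j<N. r ^ (j + J))"
    using sum.shift_bounds_nat_ivl[of "\<lambda>j. r ^ j" 0 J N] by (simp add: atLeast0LessThan add.commute)
  finally show ?thesis
    by (simp add: qint_def sum_distrib_left power_add mult.commute)
qed

abbreviation (input) alt_var :: "nat \<Rightarrow> 'a::comm_ring_1 \<Rightarrow> 'a" where
  "alt_var n q \<equiv> (- 1) ^ n * q"

text \<open>In decreasing order the letter \<open>(b, s)\<close> has rank
  \<open>s * n + (n - b)\<close>, with one block of \<open>n\<close> ranks per color. The bound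
  counts the previous letters after which \<open>(a, t)\<close> makes a descent: \<open>n\<close>
  for each color below \<open>t\<close>, and the values from \<open>a\<close> to \<open>n\<close> in
  color \<open>t\<close>.\<close>

lemma last_letter_rank_less_iff:
  fixes a b n s t :: nat
  assumes "b \<in> {1..n}" "1 \<le> a" "a \<le> Suc n"
  shows "s * n + (n - b) < t * n + (Suc n - a) \<longleftrightarrow> s < t \<or> s = t \<and> a \<le> b"
proof -
  consider "s < t" | "s = t" | "t < s" by linarith
  then show ?thesis
  proof cases
    case 1
    then have "Suc s * n \<le> t * n" by (intro mult_le_mono1) simp
    then show ?thesis using 1 assms by auto
  next
    case 2
    then show ?thesis using assms by auto
  next
    case 3
    then have "Suc t * n \<le> s * n" by (intro mult_le_mono1) simp
    then show ?thesis using 3 assms by auto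
  qed
qed

text \<open>Each color fills a block of \<open>n\<close> consecutive ranks, and the \<open>c\<close>
  blocks tile the range below \<open>c * n\<close>.\<close>

lemma sum_last_letter_rank:
  fixes f :: "nat \<Rightarrow> 'a::comm_ring_1"
  shows "(\<Sum>(b, s)\<in>{1..n} \<times> {..<c}. f (s * n + (n - b))) = (\<Sum>j<c * n. f j)"
proof -
  have "(\<Sum>b\<in>{1..n}. f (s * n + (n - b))) = sum f {s * n..<s * n + n}" for s
    by (rule sum.reindex_bij_witness[of _ "\<lambda>j. s * n + n - j" "\<lambda>b. s * n + (n - b)"]) auto
  then show ?thesis
    by (simp flip: sum.cartesian_product sum.nat_group) (subst sum.swap, simp)
qed

lemma last_letter_in:
  "x \<in> colored_perms c n \<Longrightarrow> n \<ge> 1 \<Longrightarrow> (fst x n, snd x n) \<in> {1..n} \<times> {..<c}"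
  using permutes_in_image[of "fst x" "{1..n}" n]
  by (auto simp: colored_perms_def PiE_iff)

lemma sum_by_last_letter:
  fixes f :: "cperm \<Rightarrow> 'a::comm_ring_1"
  assumes "n \<ge> 1"
  shows "(\<Sum>x\<in>colored_perms c n. f x * g (fst x n, snd x n)) =
    (\<Sum>y\<in>{1..n} \<times> {..<c}. (\<Sum>x\<in>{x \<in> colored_perms c n. (fst x n, snd x n) = y}. f x) * g y)"
proof -
  have "(\<Sum>x\<in>colored_perms c n. f x * g (fst x n, snd x n)) =
    (\<Sum>y\<in>{1..n} \<times> {..<c}. \<Sum>x\<in>{x \<in> colored_perms c n. (fst x n, snd x n) = y}. f x * g (fst x n, snd x n))"
    using last_letter_in[OF _ assms]
    by (intro sum.group[symmetric] finite_colored_perms) auto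
  also have "\<dots> = (\<Sum>y\<in>{1..n} \<times> {..<c}. \<Sum>x\<in>{x \<in> colored_perms c n. (fst x n, snd x n) = y}. f x * g y)"
    by (intro sum.cong refl) auto
  finally show ?thesis by (simp add: sum_distrib_right)
qed

lemma sum_with_last_letter:
  fixes f :: "cperm \<Rightarrow> 'a::comm_ring_1"
  assumes "a \<in> {1..Suc n}" "t < c"
  shows "(\<Sum>x\<in>{x \<in> colored_perms c (Suc n). (fst x (Suc n), snd x (Suc n)) = (a, t)}. f x) =
    (\<Sum>x\<in>colored_perms c n. f (append_colored n a t x))"
proof -
  have last: "fst (append_colored n b s x) (Suc n) = b" "snd (append_colored n b s x) (Suc n) = s"
    if "x \<in> colored_perms c n" for b s x
    using that by (auto simp: append_colored_def colored_perms_def permutes_not_in)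
  have inj: "inj_on (\<lambda>((a, t), x). append_colored n a t x) (({1..Suc n} \<times> {..<c}) \<times> colored_perms c n)"
    and img: "(\<lambda>((a, t), x). append_colored n a t x) ` (({1..Suc n} \<times> {..<c}) \<times> colored_perms c n)
      = colored_perms c (Suc n)"
    using bij_betw_append_colored by (auto simp: bij_betw_def)
  have "inj_on (append_colored n a t) (colored_perms c n)"
    using inj_onD[OF inj, of "((a, t), _)" "((a, t), _)"] assms by (auto intro!: inj_onI)
  moreover have "append_colored n a t ` colored_perms c n =
      {x \<in> colored_perms c (Suc n). (fst x (Suc n), snd x (Suc n)) = (a, t)}"
    unfolding img[symmetric] using assms by (force simp: last)
  ultimately show ?thesis
    by (metis (no_types, lifting) sum.reindex_cong)
qed

lemma signed_weight_0: "x \<in> colored_perms c 0 \<Longrightarrow> signed_weight c 0 q x = 1"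
  by (auto simp: colored_perms_def signed_weight_def col_def inv_count_def fmaj_def maj_def Des_def)

lemma card_colored_perms_0: "card (colored_perms c 0) = 1"
  by (simp add: colored_perms_def card_cartesian_product)

text \<open>
  The number \<open>t (n + 1) + (n + 1 - a)\<close> is the rank of the last letter \<open>(a, t)\<close> in decreasing letter
  order. Appending a letter multiplies by \<open>q\<^sup>c\<^sup>n\<close> exactly the terms whose last letter has smaller rank,
  so it shifts a geometric progression of length \<open>c n\<close> cyclically. As \<open>c\<close> is even,
  \<open>q\<^sup>c\<^sup>n\<close> is also the power \<open>c n\<close> of \<open>- q\<close>.
\<close>

lemma signed_sum_with_last_letter:
  fixes q :: "'a::comm_ring_1"
  assumes "even c" "a \<in> {1..Suc n}" "t < c"
  shows "(\<Sum>x\<in>{x \<in> colored_perms c (Suc n). (fst x (Suc n), snd x (Suc n)) = (a, t)}.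
      signed_weight c (Suc n) q x) =
    alt_var (Suc n) q ^ (t * Suc n + (Suc n - a)) * (\<Prod>i=1..n. qint (i * c) (alt_var i q))"
  using assms(2,3)
proof (induction n arbitrary: a t)
  case 0
  have "(\<Sum>x\<in>colored_perms c 0. signed_weight c (Suc 0) q (append_colored 0 a t x)) =
      (\<Sum>x\<in>colored_perms c 0. (- q) ^ t)"
  proof (intro sum.cong refl)
    fix x assume x: "x \<in> colored_perms c 0"
    obtain p \<tau> where "x = (p, \<tau>)" by (cases x)
    then show "signed_weight c (Suc 0) q (append_colored 0 a t x) = (- q) ^ t"
      using 0 signed_weight_append_colored[of p \<tau> c 0 a q t] x signed_weight_0[OF x, of q] by simp
  qed
  then show ?case
    using 0 by (subst sum_with_last_letter) (auto simp: card_colored_perms_0)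
next
  case (Suc n)
  define m where "m = Suc n"
  define r where "r = alt_var m q"
  define C where "C = (\<Prod>i=1..n. qint (i * c) (alt_var i q))"
  \<comment> \<open>\<open>g\<close> is the factor gained when the new letter \<open>(a, t)\<close>
    creates a descent at position \<open>m\<close>.\<close>
  define g where "g = (\<lambda>(b, s). if s < t \<or> s = t \<and> a \<le> b then q ^ (c * m) else 1 :: 'a)"
  have a: "1 \<le> a" "a \<le> Suc m" using Suc.prems by (auto simp: m_def)
  have rcm: "q ^ (c * m) = r ^ (c * m)"
    using assms(1) by (simp add: r_def power_mult_distrib flip: power_mult)
  have "(\<Sum>x\<in>{x \<in> colored_perms c (Suc m). (fst x (Suc m), snd x (Suc m)) = (a, t)}.
      signed_weight c (Suc m) q x) =
    (\<Sum>x\<in>colored_perms c m. (- q) ^ t * (- 1) ^ (Suc m - a) *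
       (signed_weight c m q x * g (fst x m, snd x m)))"
    using Suc.prems a
    by (subst sum_with_last_letter)
      (auto simp: m_def[symmetric] g_def signed_weight_append_colored intro!: sum.cong)
  also have "\<dots> = (- q) ^ t * (- 1) ^ (Suc m - a) *
      (\<Sum>x\<in>colored_perms c m. signed_weight c m q x * g (fst x m, snd x m))"
    by (simp add: sum_distrib_left)
  also have "(\<Sum>x\<in>colored_perms c m. signed_weight c m q x * g (fst x m, snd x m)) =
      (\<Sum>(b, s)\<in>{1..m} \<times> {..<c}. (r ^ (s * m + (m - b)) * C) * g (b, s))"
  proof (subst sum_by_last_letter)
    show "1 \<le> m" by (simp add: m_def)
    show "(\<Sum>y\<in>{1..m} \<times> {..<c}. (\<Sum>x\<in>{x \<in> colored_perms c m. (fst x m, snd x m) = y}.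
        signed_weight c m q x) * g y) =
      (\<Sum>(b, s)\<in>{1..m} \<times> {..<c}. (r ^ (s * m + (m - b)) * C) * g (b, s))"
      unfolding m_def r_def C_def
      by (intro sum.cong refl) (clarify, subst Suc.IH, auto)
  qed
  \<comment> \<open>The descent condition becomes a bound on the rank of the old last letter, as the
    cyclic shift requires.\<close>
  also have "\<dots> = C * (\<Sum>(b, s)\<in>{1..m} \<times> {..<c}. (\<lambda>j. r ^ j *
      (if j < t * m + (Suc m - a) then r ^ (c * m) else 1)) (s * m + (m - b)))"
    unfolding sum_distrib_left
  proof (intro sum.cong refl, clarify)
    fix b s assume "b \<in> {1..m}"
    then show "r ^ (s * m + (m - b)) * C * g (b, s) =
        C * (r ^ (s * m + (m - b)) * (if s * m + (m - b) < t * m + (Suc m - a) then r ^ (c * m) else 1))"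
      by (simp only: last_letter_rank_less_iff[OF _ a] g_def rcm prod.case) (simp only: mult_ac)
  qed
  also have "\<dots> = C * (\<Sum>j<c * m. r ^ j * (if j < t * m + (Suc m - a) then r ^ (c * m) else 1))"
    by (subst sum_last_letter_rank) simp
  also have "\<dots> = C * (r ^ (t * m + (Suc m - a)) * qint (c * m) r)"
  proof (subst cyclic_shift_geometric_sum)
    \<comment> \<open>The bound stays within the progression, since \<open>t < c\<close> and
      \<open>Suc m - a \<le> m\<close>.\<close>
    have "t * m + m = Suc t * m" by simp
    also have "\<dots> \<le> c * m"
      using Suc.prems by (intro mult_le_mono1) simp
    finally show "t * m + (Suc m - a) \<le> c * m" using a by linarith
  qed simp
  also have "(- q) ^ t * (- 1) ^ (Suc m - a) * (C * (r ^ (t * m + (Suc m - a)) * qint (c * m) r)) =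
      alt_var (Suc m) q ^ (t * Suc m + (Suc m - a)) * (C * qint (m * c) r)"
  proof -
    have *: "(- q) ^ t * (- 1) ^ k * r ^ (t * m + k) = alt_var (Suc m) q ^ (t * Suc m + k)" for k
    proof -
      \<comment> \<open>The two exponents of -1 differ by \<open>2 * m * t\<close>.\<close>
      have "even (t + k + m * (t * m + k)) \<longleftrightarrow> even (Suc m * (t * Suc m + k))"
        by auto
      then have "(- 1 :: 'a) ^ (t + k + m * (t * m + k)) = (- 1) ^ (Suc m * (t * Suc m + k))"
        by (simp only: minus_one_power_iff)
      moreover have "(- q) ^ t * (- 1) ^ k * r ^ (t * m + k) =
          (- 1) ^ (t + k + m * (t * m + k)) * q ^ (t + (t * m + k))"
        by (simp only: r_def power_add power_mult power_mult_distrib power_minus[of q t])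
          (simp only: mult_ac)
      moreover have "alt_var (Suc m) q ^ (t * Suc m + k) =
          (- 1) ^ (Suc m * (t * Suc m + k)) * q ^ (t * Suc m + k)"
        by (simp only: power_mult power_mult_distrib)
      moreover have "t + (t * m + k) = t * Suc m + k"
        by simp
      ultimately show ?thesis by metis
    qed
    show ?thesis
      unfolding *[symmetric] by (simp only: mult_ac)
  qed
  finally show ?case
    by (simp add: m_def r_def C_def)
qed

text \<open>As the last letter varies, its rank takes each value below \<open>c * n\<close> once, so
  the refined sums add up to the factor for \<open>i = n\<close>.\<close>

theorem signed_mahonian:
  fixes q :: "'a::comm_ring_1"
  assumes "even c"
  shows "(\<Sum>x\<in>colored_perms c n. signed_weight c n q x) = (\<Prod>i=1..n. qint (i * c) (alt_var i q))"
proof (cases n)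
  case 0
  then show ?thesis
    using card_colored_perms_0[of c] by (simp add: signed_weight_0)
next
  case (Suc m)
  let ?C = "\<Prod>i=1..m. qint (i * c) (alt_var i q)"
  have "(\<Sum>x\<in>colored_perms c n. signed_weight c n q x) =
      (\<Sum>y\<in>{1..n} \<times> {..<c}. \<Sum>x\<in>{x \<in> colored_perms c n. (fst x n, snd x n) = y}. signed_weight c n q x)"
    using sum_by_last_letter[of n "signed_weight c n q" "\<lambda>_. 1" c] Suc by simp
  also have "\<dots> = (\<Sum>(a, t)\<in>{1..n} \<times> {..<c}. (\<lambda>j. alt_var n q ^ j * ?C) (t * n + (n - a)))"
    unfolding Suc by (intro sum.cong refl) (clarify, subst signed_sum_with_last_letter[OF assms], auto)
  also have "\<dots> = (\<Sum>j<c * n. alt_var n q ^ j * ?C)"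
    by (rule sum_last_letter_rank)
  also have "\<dots> = ?C * qint (n * c) (alt_var n q)"
    by (simp add: qint_def sum_distrib_right[symmetric] mult.commute)
  finally show ?thesis by (simp add: Suc)
qed

section \<open>Shuffles with an increasing word\<close>

text \<open>For \<open>i\<close> outside \<open>S\<close> this is the index of \<open>i\<close>
  after deletion of \<open>S\<close>. It serves for positions and letters alike, as a fixed point
  removes the same number from both.\<close>

definition rank_off :: "nat set \<Rightarrow> nat \<Rightarrow> nat" where
  "rank_off S i = card ({1..i} - S)"

text \<open>
  Fixed points occupy the positions in \<open>S\<close>, the letters of a derangement the other ones. \<open>Lo j\<close> says
  that the \<open>j\<close>-th letter of the derangement is smaller than a fixed point next to it, and \<open>D j\<close> that
  \<open>j\<close> is a descent of the derangement.
\<close>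

definition shuffle_desc :: "(nat \<Rightarrow> bool) \<Rightarrow> (nat \<Rightarrow> bool) \<Rightarrow> nat set \<Rightarrow> nat \<Rightarrow> bool" where
  "shuffle_desc Lo D S i =
     (if i \<in> S then Suc i \<notin> S \<and> Lo (rank_off S (Suc i))
      else if Suc i \<in> S then \<not> Lo (rank_off S i) else D (rank_off S i))"

definition shuffle_maj :: "(nat \<Rightarrow> bool) \<Rightarrow> (nat \<Rightarrow> bool) \<Rightarrow> nat \<Rightarrow> nat set \<Rightarrow> nat" where
  "shuffle_maj Lo D n S = (\<Sum>i\<in>{1..<n}. if shuffle_desc Lo D S i then i else 0)"

definition subsets_of_size :: "nat \<Rightarrow> nat \<Rightarrow> nat set set" where
  "subsets_of_size n k = {T. T \<subseteq> {1..n} \<and> card T = k}"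

lemma finite_subsets_of_size: "finite (subsets_of_size n k)"
  by (rule finite_subset[of _ "Pow {1..n}"]) (auto simp: subsets_of_size_def)

lemma shuffle_maj_Suc:
  "shuffle_maj Lo D (Suc n) S = shuffle_maj Lo D n S + (if shuffle_desc Lo D S n then n else 0)"
  by (cases n) (auto simp: shuffle_maj_def)

lemma rank_off_insert: "i \<le> n \<Longrightarrow> rank_off (insert (Suc n) T) i = rank_off T i"
  by (auto simp: rank_off_def intro!: arg_cong[where f = card])

lemma shuffle_maj_insert: "shuffle_maj Lo D n (insert (Suc n) T) = shuffle_maj Lo D n T"
  unfolding shuffle_maj_def by (intro sum.cong refl) (auto simp: shuffle_desc_def rank_off_insert)

lemma rank_off_subset: "T \<subseteq> {1..n} \<Longrightarrow> rank_off T n = n - card T"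
  by (simp add: rank_off_def card_Diff_subset finite_subset)

lemma rank_off_Suc: "rank_off T (Suc n) = (if Suc n \<in> T then rank_off T n else Suc (rank_off T n))"
  by (auto simp: rank_off_def atLeastAtMostSuc_conv insert_Diff_if)

context
  fixes Lo D :: "nat \<Rightarrow> bool" and Q :: "'a::comm_ring_1"
begin

text \<open>Here \<open>m\<close> counts the derangement letters and \<open>k\<close> the fixed
  points. Splitting by the kind of the last position closes the recursion: whether a further letter
  of given kind creates a descent depends only on that kind and on \<open>m\<close>.\<close>

definition shuffle_fixed_last :: "nat \<Rightarrow> nat \<Rightarrow> 'a" where
  "shuffle_fixed_last m k =
     (\<Sum>T\<in>{T \<in> subsets_of_size (m + k) k. m + k \<in> T}. Q ^ shuffle_maj Lo D (m + k) T)"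

definition shuffle_moved_last :: "nat \<Rightarrow> nat \<Rightarrow> 'a" where
  "shuffle_moved_last m k =
     (\<Sum>T\<in>{T \<in> subsets_of_size (m + k) k. m + k \<notin> T}. Q ^ shuffle_maj Lo D (m + k) T)"

lemma sum_subsets_by_last:
  "(\<Sum>T\<in>subsets_of_size n k. Q ^ shuffle_maj Lo D n T * (if n \<in> T then u else v)) =
    u * (\<Sum>T\<in>{T \<in> subsets_of_size n k. n \<in> T}. Q ^ shuffle_maj Lo D n T) +
    v * (\<Sum>T\<in>{T \<in> subsets_of_size n k. n \<notin> T}. Q ^ shuffle_maj Lo D n T)"
proof -
  have "subsets_of_size n k =
      {T \<in> subsets_of_size n k. n \<in> T} \<union> {T \<in> subsets_of_size n k. n \<notin> T}"
    by auto
  then have "(\<Sum>T\<in>subsets_of_size n k. Q ^ shuffle_maj Lo D n T * (if n \<in> T then u else v)) =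
      (\<Sum>T\<in>{T \<in> subsets_of_size n k. n \<in> T}. Q ^ shuffle_maj Lo D n T * (if n \<in> T then u else v)) +
      (\<Sum>T\<in>{T \<in> subsets_of_size n k. n \<notin> T}. Q ^ shuffle_maj Lo D n T * (if n \<in> T then u else v))"
    by (subst sum.union_disjoint[symmetric]) (auto simp: finite_subsets_of_size)
  then show ?thesis
    by (simp add: sum_distrib_left mult.commute)
qed

lemma shuffle_sum_eq:
  "(\<Sum>T\<in>subsets_of_size (m + k) k. Q ^ shuffle_maj Lo D (m + k) T) =
    shuffle_fixed_last m k + shuffle_moved_last m k"
  using sum_subsets_by_last[where n = "m + k" and k = k and u = 1 and v = 1]
  by (simp add: shuffle_fixed_last_def shuffle_moved_last_def)

text \<open>A fixed point appended at the end creates a descent exactly behind a derangement letter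
  that is not low.\<close>

lemma shuffle_fixed_last_Suc:
  "shuffle_fixed_last m (Suc k) =
    shuffle_fixed_last m k + (if Lo m then 1 else Q ^ (m + k)) * shuffle_moved_last m k"
proof -
  let ?n = "m + k"
  have inj: "inj_on (insert (Suc ?n)) (subsets_of_size ?n k)"
    by (rule inj_onI) (auto simp: subsets_of_size_def dest!: insert_ident[THEN iffD1, rotated 2])
  have "{T \<in> subsets_of_size (Suc ?n) (Suc k). Suc ?n \<in> T} =
      insert (Suc ?n) ` subsets_of_size ?n k"
  proof (intro equalityI subsetI)
    fix T assume "T \<in> {T \<in> subsets_of_size (Suc ?n) (Suc k). Suc ?n \<in> T}"
    then have T: "T \<subseteq> {1..Suc ?n}" "card T = Suc k" "Suc ?n \<in> T"
      by (auto simp: subsets_of_size_def)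
    have "T - {Suc ?n} \<subseteq> {1..?n}"
      using T by (auto simp: le_Suc_eq)
    moreover have "card (T - {Suc ?n}) = k"
      using T by simp
    moreover have "T = insert (Suc ?n) (T - {Suc ?n})"
      using T by auto
    ultimately show "T \<in> insert (Suc ?n) ` subsets_of_size ?n k"
      unfolding subsets_of_size_def by blast
  next
    fix T assume "T \<in> insert (Suc ?n) ` subsets_of_size ?n k"
    then obtain U where U: "U \<subseteq> {1..?n}" "card U = k" "T = insert (Suc ?n) U"
      by (auto simp: subsets_of_size_def)
    moreover from this have "finite U" "Suc ?n \<notin> U"
      by (auto intro: finite_subset)
    ultimately show "T \<in> {T \<in> subsets_of_size (Suc ?n) (Suc k). Suc ?n \<in> T}"
      by (auto simp: subsets_of_size_def)
  qed
  then have "shuffle_fixed_last m (Suc k) =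
      (\<Sum>T\<in>subsets_of_size ?n k. Q ^ shuffle_maj Lo D (Suc ?n) (insert (Suc ?n) T))"
    by (simp add: shuffle_fixed_last_def sum.reindex[OF inj])
  also have "\<dots> = (\<Sum>T\<in>subsets_of_size ?n k. Q ^ shuffle_maj Lo D ?n T *
      (if ?n \<in> T then 1 else if Lo m then 1 else Q ^ (m + k)))"
  proof (intro sum.cong refl)
    fix T assume "T \<in> subsets_of_size ?n k"
    then have "rank_off T ?n = m" by (auto simp: subsets_of_size_def rank_off_subset)
    then have "shuffle_desc Lo D (insert (Suc ?n) T) ?n \<longleftrightarrow> ?n \<notin> T \<and> \<not> Lo m"
      by (simp add: shuffle_desc_def rank_off_insert)
    then show "Q ^ shuffle_maj Lo D (Suc ?n) (insert (Suc ?n) T) = Q ^ shuffle_maj Lo D ?n T *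
      (if ?n \<in> T then 1 else if Lo m then 1 else Q ^ (m + k))"
      by (simp add: shuffle_maj_Suc shuffle_maj_insert power_add)
  qed
  also have "\<dots> = shuffle_fixed_last m k + (if Lo m then 1 else Q ^ (m + k)) * shuffle_moved_last m k"
    unfolding sum_subsets_by_last shuffle_fixed_last_def shuffle_moved_last_def by simp
  finally show ?thesis .
qed

text \<open>Behind a fixed point, letter \<open>Suc m\<close> makes a descent when it is low; behind
  letter \<open>m\<close>, the derangement itself decides through \<open>D m\<close>.\<close>

lemma shuffle_moved_last_Suc:
  "shuffle_moved_last (Suc m) k =
    (if Lo (Suc m) then Q ^ (m + k) else 1) * shuffle_fixed_last m k +
    (if D m then Q ^ (m + k) else 1) * shuffle_moved_last m k"
proof -
  let ?n = "m + k"
  have "T \<subseteq> {1..Suc ?n} \<and> Suc ?n \<notin> T \<longleftrightarrow> T \<subseteq> {1..?n}" for T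
    by (auto simp: atLeastAtMostSuc_conv subset_insert)
  then have "{T \<in> subsets_of_size (Suc ?n) k. Suc ?n \<notin> T} = subsets_of_size ?n k"
    unfolding subsets_of_size_def by blast
  then have "shuffle_moved_last (Suc m) k =
      (\<Sum>T\<in>subsets_of_size ?n k. Q ^ shuffle_maj Lo D (Suc ?n) T)"
    by (simp add: shuffle_moved_last_def)
  also have "\<dots> = (\<Sum>T\<in>subsets_of_size ?n k. Q ^ shuffle_maj Lo D ?n T *
      (if ?n \<in> T then if Lo (Suc m) then Q ^ (m + k) else 1 else if D m then Q ^ (m + k) else 1))"
  proof (intro sum.cong refl)
    fix T assume T: "T \<in> subsets_of_size ?n k"
    then have m: "rank_off T ?n = m" by (auto simp: subsets_of_size_def rank_off_subset)
    have "Suc ?n \<notin> T" using T by (auto simp: subsets_of_size_def)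
    then have "shuffle_desc Lo D T ?n \<longleftrightarrow> (if ?n \<in> T then Lo (Suc m) else D m)"
      by (simp add: shuffle_desc_def rank_off_Suc m)
    then show "Q ^ shuffle_maj Lo D (Suc ?n) T = Q ^ shuffle_maj Lo D ?n T *
      (if ?n \<in> T then if Lo (Suc m) then Q ^ (m + k) else 1 else if D m then Q ^ (m + k) else 1)"
      by (simp add: shuffle_maj_Suc power_add)
  qed
  also have "\<dots> = (if Lo (Suc m) then Q ^ (m + k) else 1) * shuffle_fixed_last m k +
    (if D m then Q ^ (m + k) else 1) * shuffle_moved_last m k"
    unfolding sum_subsets_by_last shuffle_fixed_last_def shuffle_moved_last_def by simp
  finally show ?thesis .
qed

lemma shuffle_fixed_last_0: "shuffle_fixed_last m 0 = 0"
proof -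
  have "{T \<in> subsets_of_size m 0. m \<in> T} = {}"
    by (auto simp: subsets_of_size_def dest: finite_subset)
  then show ?thesis by (simp only: shuffle_fixed_last_def add_0_right sum.empty)
qed

text \<open>The empty shuffle is counted as ending in a derangement letter, which starts the
  recursion.\<close>

lemma shuffle_moved_last_0_0: "shuffle_moved_last 0 0 = 1"
proof -
  have "{T \<in> subsets_of_size 0 0. 0 \<notin> T} = {{}}"
    by (auto simp: subsets_of_size_def)
  then show ?thesis by (simp add: shuffle_moved_last_def shuffle_maj_def)
qed

lemma shuffle_moved_last_0_Suc: "shuffle_moved_last 0 (Suc k) = 0"
proof -
  have "{T \<in> subsets_of_size (Suc k) (Suc k). Suc k \<notin> T} = {}"
  proof -
    have "T = {1..Suc k}" if "T \<in> subsets_of_size (Suc k) (Suc k)" for T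
      using that by (intro card_subset_eq) (auto simp: subsets_of_size_def)
    then show ?thesis by fastforce
  qed
  then show ?thesis by (simp only: shuffle_moved_last_def add_0_left sum.empty)
qed

lemma shuffle_fixed_last_0_Suc: "shuffle_fixed_last 0 (Suc k) = 1"
  by (induction k)
    (simp_all add: shuffle_fixed_last_Suc shuffle_fixed_last_0 shuffle_moved_last_0_0 shuffle_moved_last_0_Suc)

end

text \<open>The induction step of \<open>shuffle_moved_last_closed\<close>: \<open>x\<close>,
  \<open>y\<close>, \<open>z\<close> are Gaussian coefficients, \<open>z1\<close> and
  \<open>z2\<close> the two Pascal rules, \<open>L1\<close> and \<open>L2\<close> tell whether the
  last two derangement letters are low, and \<open>d\<close> whether they form a descent.
  \<open>up\<close> and \<open>down\<close> exclude two of the eight cases; each other case is a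
  multiple of one Pascal rule.\<close>

lemma shuffle_step_algebra:
  fixes Qm Qk R x y z :: "'b::comm_ring_1"
  assumes z1: "z = x + Qk * y" and z2: "z = Qm * x + y"
    and up: "\<not> L1 \<Longrightarrow> L2 \<Longrightarrow> d" and down: "L1 \<Longrightarrow> \<not> L2 \<Longrightarrow> \<not> d"
  shows "(if L2 then Qm * Qk else 1) * (R * (if L1 then 1 else Qm) * x) +
      (if d then Qm * Qk else 1) * (R * (if L1 then Qk else 1) * y) =
    R * (if d then Qm else 1) * (if L2 then Qk else 1) * z"
  using up down
  by (cases L1; cases L2; cases d)
    (simp_all, ((simp add: z1 algebra_simps; fail) | (simp add: z2 algebra_simps; fail))+)

section \<open>Gaussian coefficients and the major index of shuffles\<close>

lemma choose_two_Suc: "Suc k choose 2 = (k choose 2) + k"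
  by (simp add: numeral_2_eq_2)

text \<open>The Gaussian coefficient \<open>m + k\<close> over \<open>k\<close> at \<open>q\<^sup>c\<close>; the factors \<open>[c]\<close> of \<open>qprod\<close> cancel.\<close>

definition qbinom :: "nat \<Rightarrow> 'a::field \<Rightarrow> nat \<Rightarrow> nat \<Rightarrow> 'a" where
  "qbinom c q m k = qprod c (m + k) q / (qprod c m q * qprod c k q)"

lemma qint_add: "qint (a + b) q = qint a q + q ^ a * qint b q"
proof -
  have "qint (a + b) q = (\<Sum>i<a. q ^ i) + (\<Sum>i\<in>{a..<a + b}. q ^ i)"
    unfolding qint_def by (simp add: sum.union_disjoint[symmetric] ivl_disj_un ivl_disj_int)
  also have "(\<Sum>i\<in>{a..<a + b}. q ^ i) = (\<Sum>i<b. q ^ (i + a))"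
    using sum.shift_bounds_nat_ivl[of "\<lambda>j. q ^ j" 0 a b] by (simp add: atLeast0LessThan add.commute)
  finally show ?thesis
    by (simp add: qint_def sum_distrib_left power_add mult.commute)
qed

lemma qprod_Suc: "qprod c (Suc k) q = qprod c k q * qint (Suc k * c) q"
  by (simp add: qprod_def)

lemma qprod_0: "qprod c 0 q = 1"
  by (simp add: qprod_def)

context
  fixes c :: nat and q :: "'a::field"
  assumes qint_nonzero: "\<forall>i\<ge>1. qint (i * c) q \<noteq> 0"
begin

lemma qint_nz: "i \<ge> 1 \<Longrightarrow> qint (i * c) q \<noteq> 0"
  using qint_nonzero by blast

lemma qprod_nz: "qprod c k q \<noteq> 0"
  by (auto simp: qprod_def qint_nz)

lemma qbinom_0: "qbinom c q 0 k = 1" "qbinom c q m 0 = 1"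
  by (simp_all add: qbinom_def qprod_0 qprod_nz)

text \<open>All three coefficients are multiples of the quotient \<open>?P\<close>, so both rules
  reduce to \<open>qint_add\<close>, with the blocks of length \<open>Suc k * c\<close> and
  \<open>Suc m * c\<close> taken in either order.\<close>

lemma qbinom_pascal:
  "qbinom c q (Suc m) (Suc k) = qbinom c q (Suc m) k + (q ^ c) ^ Suc k * qbinom c q m (Suc k)"
  "qbinom c q (Suc m) (Suc k) = (q ^ c) ^ Suc m * qbinom c q (Suc m) k + qbinom c q m (Suc k)"
proof -
  let ?P = "qprod c (Suc (m + k)) q / (qprod c (Suc m) q * qprod c (Suc k) q)"
  have 1: "qbinom c q (Suc m) (Suc k) = ?P * qint (Suc (Suc (m + k)) * c) q"
    by (simp add: qbinom_def qprod_Suc)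
  have 2: "qbinom c q (Suc m) k = ?P * qint (Suc k * c) q"
    using qint_nz[of "Suc k"] qprod_nz by (simp add: qbinom_def qprod_Suc[of c k] del: mult_Suc)
  have 3: "qbinom c q m (Suc k) = ?P * qint (Suc m * c) q"
    using qint_nz[of "Suc m"] qprod_nz by (simp add: qbinom_def qprod_Suc[of c m] del: mult_Suc)
  have e: "Suc (Suc (m + k)) * c = Suc k * c + Suc m * c" "Suc (Suc (m + k)) * c = Suc m * c + Suc k * c"
    by (simp_all add: algebra_simps)
  have "qint (Suc (Suc (m + k)) * c) q = qint (Suc k * c) q + (q ^ c) ^ Suc k * qint (Suc m * c) q"
    unfolding e(1) qint_add by (simp add: power_mult[symmetric] mult.commute del: power_Suc mult_Suc mult_Suc_right)
  then show "qbinom c q (Suc m) (Suc k) = qbinom c q (Suc m) k + (q ^ c) ^ Suc k * qbinom c q m (Suc k)"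
    unfolding 1 2 3 by (simp only: distrib_left mult_ac)
  have "qint (Suc (Suc (m + k)) * c) q = qint (Suc m * c) q + (q ^ c) ^ Suc m * qint (Suc k * c) q"
    unfolding e(2) qint_add by (simp add: power_mult[symmetric] mult.commute del: power_Suc mult_Suc mult_Suc_right)
  then show "qbinom c q (Suc m) (Suc k) = (q ^ c) ^ Suc m * qbinom c q (Suc m) k + qbinom c q m (Suc k)"
    unfolding 1 2 3 by (simp only: distrib_left mult_ac add_ac)
qed

text \<open>\<open>R\<close> stands for the descents within the derangement. At each step of the
  recursion in \<open>k\<close>, the first Pascal rule absorbs one term of
  \<open>shuffle_moved_last\<close>, whether or not the last letter is low.\<close>

lemma shuffle_fixed_last_closed:
  fixes Lo D :: "nat \<Rightarrow> bool"
  assumes "\<And>k. shuffle_moved_last Lo D (q ^ c) (Suc m) k = R * (if Lo (Suc m) then (q ^ c) ^ k else 1) * qbinom c q m k"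
  shows "shuffle_fixed_last Lo D (q ^ c) (Suc m) (Suc k) =
    R * (if Lo (Suc m) then 1 else (q ^ c) ^ Suc m) * qbinom c q (Suc m) k"
proof (induction k)
  case 0
  show ?case
    unfolding shuffle_fixed_last_Suc[of _ _ _ _ 0] assms by (simp add: shuffle_fixed_last_0 qbinom_0)
next
  case (Suc k)
  have "(q ^ c) ^ (Suc m + Suc k) = (q ^ c) ^ Suc m * (q ^ c) ^ Suc k"
    by (rule power_add)
  then show ?case
    unfolding shuffle_fixed_last_Suc[of _ _ _ _ "Suc k"] Suc.IH assms
    by (simp only: qbinom_pascal(1)[of m k] if_distrib if_cancel)
      (auto simp only: distrib_left mult_ac if_True if_False mult_1_left mult_1_right split: if_splits)
qed

text \<open>The hypotheses say that a change of letter type forces a descent or an ascent. The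
  induction keeps \<open>k\<close> arbitrary, because \<open>shuffle_fixed_last_closed\<close> needs
  the formula for all \<open>k\<close>. For \<open>m = 0\<close> the factor
  \<open>(q ^ c) ^ k\<close> is the descent from \<open>k\<close> fixed points to a low
  letter.\<close>

lemma shuffle_moved_last_closed:
  fixes Lo D :: "nat \<Rightarrow> bool"
  assumes "\<And>j. 1 \<le> j \<Longrightarrow> j \<le> m \<Longrightarrow> \<not> Lo j \<Longrightarrow> Lo (Suc j) \<Longrightarrow> D j"
    and "\<And>j. 1 \<le> j \<Longrightarrow> j \<le> m \<Longrightarrow> Lo j \<Longrightarrow> \<not> Lo (Suc j) \<Longrightarrow> \<not> D j"
  shows "shuffle_moved_last Lo D (q ^ c) (Suc m) k =
    (q ^ c) ^ (\<Sum>j\<in>{1..<Suc m}. if D j then j else 0) *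
      (if Lo (Suc m) then (q ^ c) ^ k else 1) * qbinom c q m k"
  using assms
proof (induction m arbitrary: k)
  case 0
  show ?case
    by (cases k) (simp_all add: shuffle_moved_last_Suc shuffle_fixed_last_0 shuffle_moved_last_0_0
        shuffle_moved_last_0_Suc shuffle_fixed_last_0_Suc qbinom_0)
next
  case (Suc m)
  define R where "R = (q ^ c) ^ (\<Sum>j\<in>{1..<Suc m}. if D j then j else 0)"
  have IH: "shuffle_moved_last Lo D (q ^ c) (Suc m) k =
      R * (if Lo (Suc m) then (q ^ c) ^ k else 1) * qbinom c q m k" for k
    unfolding R_def using Suc.prems by (intro Suc.IH) auto
  have R': "(q ^ c) ^ (\<Sum>j\<in>{1..<Suc (Suc m)}. if D j then j else 0) =
      R * (if D (Suc m) then (q ^ c) ^ Suc m else 1)"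
    by (simp add: R_def power_add)
  show ?case
  proof (cases k)
    case 0
    then show ?thesis
      unfolding R' shuffle_moved_last_Suc[of _ _ _ "Suc m"] IH by (simp add: shuffle_fixed_last_0 qbinom_0)
  next
    case (Suc k')
    have add: "(q ^ c) ^ (Suc m + Suc k') = (q ^ c) ^ Suc m * (q ^ c) ^ Suc k'"
      by (rule power_add)
    have up: "\<not> Lo (Suc m) \<Longrightarrow> Lo (Suc (Suc m)) \<Longrightarrow> D (Suc m)"
      and down: "Lo (Suc m) \<Longrightarrow> \<not> Lo (Suc (Suc m)) \<Longrightarrow> \<not> D (Suc m)"
      using Suc.prems[of "Suc m"] by auto
    show ?thesis
      unfolding Suc R' shuffle_moved_last_Suc[of _ _ _ "Suc m"] IH shuffle_fixed_last_closed[OF IH] add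
      by (rule shuffle_step_algebra[OF qbinom_pascal up down])
  qed
qed

text \<open>A shuffle theorem in the style of Garsia and Gessel: the result does not depend on which
  letters are low. The two closed forms add up by the first Pascal rule if the last derangement
  letter is low and by the second otherwise.\<close>

theorem shuffle_maj_sum:
  fixes Lo D :: "nat \<Rightarrow> bool"
  assumes up: "\<And>j. 1 \<le> j \<Longrightarrow> j < m \<Longrightarrow> \<not> Lo j \<Longrightarrow> Lo (Suc j) \<Longrightarrow> D j"
    and down: "\<And>j. 1 \<le> j \<Longrightarrow> j < m \<Longrightarrow> Lo j \<Longrightarrow> \<not> Lo (Suc j) \<Longrightarrow> \<not> D j"
  shows "(\<Sum>T\<in>subsets_of_size (m + k) k. (q ^ c) ^ shuffle_maj Lo D (m + k) T) =
    (q ^ c) ^ (\<Sum>j\<in>{1..<m}. if D j then j else 0) * qbinom c q m k"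
proof (cases m)
  case 0
  show ?thesis
    unfolding shuffle_sum_eq 0
    by (cases k) (simp_all add: shuffle_fixed_last_0 shuffle_moved_last_0_0
        shuffle_moved_last_0_Suc shuffle_fixed_last_0_Suc qbinom_0)
next
  case (Suc l)
  define R where "R = (q ^ c) ^ (\<Sum>j\<in>{1..<m}. if D j then j else 0)"
  have moved: "shuffle_moved_last Lo D (q ^ c) (Suc l) k =
      R * (if Lo (Suc l) then (q ^ c) ^ k else 1) * qbinom c q l k" for k
    unfolding R_def Suc using up down Suc
    by (intro shuffle_moved_last_closed) auto
  show ?thesis
  proof (cases k)
    case 0
    then show ?thesis
      unfolding shuffle_sum_eq Suc moved by (simp add: shuffle_fixed_last_0 qbinom_0 R_def Suc)
  next
    case (Suc k')
    show ?thesis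
      unfolding shuffle_sum_eq \<open>m = Suc l\<close> Suc moved shuffle_fixed_last_closed[OF moved]
        R_def[unfolded \<open>m = Suc l\<close>, symmetric]
      using arg_cong[OF qbinom_pascal(1)[of l k'], of "\<lambda>x. R * x"]
        arg_cong[OF qbinom_pascal(2)[of l k'], of "\<lambda>x. R * x"]
      by (cases "Lo (Suc l)") (simp_all add: algebra_simps)
  qed
qed

section \<open>Inversion of Gaussian convolutions\<close>

lemma alternating_qbinom_partial_sum:
  "j \<le> k \<Longrightarrow> (\<Sum>i=0..j. (- 1) ^ i * (q ^ c) ^ (i choose 2) * qbinom c q (Suc k - i) i) =
    (- 1) ^ j * (q ^ c) ^ (Suc j choose 2) * qbinom c q (k - j) j"
proof (induction j)
  case 0
  then show ?case by (simp add: qbinom_0 choose_two_Suc)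
next
  case (Suc j)
  then obtain m where m: "k - j = Suc m" "Suc k - Suc j = Suc m" "k - Suc j = m"
    by (metis Suc_diff_Suc Suc_le_lessD diff_Suc_Suc)
  have "(\<Sum>i=0..Suc j. (- 1) ^ i * (q ^ c) ^ (i choose 2) * qbinom c q (Suc k - i) i) =
      (- 1) ^ j * (q ^ c) ^ (Suc j choose 2) * (qbinom c q (Suc m) j - qbinom c q (Suc m) (Suc j))"
    using Suc by (simp add: m algebra_simps)
  \<comment> \<open>The Pascal rule leaves only
    \<open>- (q ^ c) ^ Suc j * qbinom c q m (Suc j)\<close> of the difference, and
    \<open>Suc j\<close> completes the binomial exponent.\<close>
  also have "\<dots> = (- 1) ^ Suc j * (q ^ c) ^ (Suc (Suc j) choose 2) * qbinom c q (k - Suc j) (Suc j)"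
    unfolding qbinom_pascal(1)[of m j] m(3) choose_two_Suc[of "Suc j"] power_add by simp
  finally show ?case .
qed

text \<open>This is the \<open>q\<close>-binomial theorem at a point where the product vanishes. For
  \<open>k > 0\<close> the partial sum up to \<open>k - 1\<close> cancels the last term.\<close>

lemma alternating_qbinom_sum:
  "(\<Sum>i=0..k. (- 1) ^ i * (q ^ c) ^ (i choose 2) * qbinom c q (k - i) i) = (if k = 0 then 1 else 0)"
proof (cases k)
  case 0
  then show ?thesis by (simp add: qbinom_0 numeral_2_eq_2)
next
  case (Suc l)
  then show ?thesis
    using alternating_qbinom_partial_sum[of l l] by (simp add: qbinom_0)
qed

text \<open>After division by \<open>qprod\<close>, Gaussian convolution is multiplication of power
  series. \<open>E\<close> is a \<open>q\<close>-exponential with inverse \<open>F\<close> by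
  \<open>alternating_qbinom_sum\<close>, so \<open>A = E * B\<close> turns into
  \<open>B = F * A\<close>.\<close>

theorem qbinom_inversion:
  assumes "\<And>n. a n = (\<Sum>k=0..n. qbinom c q (n - k) k * d (n - k))"
  shows "d n = qprod c n q * (\<Sum>k=0..n. (- 1) ^ k * (q ^ c) ^ (k choose 2) / qprod c k q *
    (a (n - k) / qprod c (n - k) q))"
proof -
  let ?P = "\<lambda>k. qprod c k q"
  define E where "E = Abs_fps (\<lambda>k. 1 / ?P k)"
  define F where "F = Abs_fps (\<lambda>k. (- 1) ^ k * (q ^ c) ^ (k choose 2) / ?P k)"
  define A where "A = Abs_fps (\<lambda>k. a k / ?P k)"
  define B where "B = Abs_fps (\<lambda>k. d k / ?P k)"
  have nz: "?P k \<noteq> 0" for k by (rule qprod_nz)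
  have "F * E = 1"
  proof (rule fps_ext)
    fix k
    have "fps_nth (F * E) k = (\<Sum>i=0..k. (- 1) ^ i * (q ^ c) ^ (i choose 2) * qbinom c q (k - i) i) / ?P k"
      unfolding fps_mult_nth sum_divide_distrib
      by (intro sum.cong refl) (simp add: F_def E_def qbinom_def nz)
    then show "fps_nth (F * E) k = fps_nth 1 k"
      by (simp add: alternating_qbinom_sum qprod_0)
  qed
  moreover have "A = E * B"
  proof (rule fps_ext)
    fix k
    show "fps_nth A k = fps_nth (E * B) k"
      unfolding fps_mult_nth
      by (simp add: A_def E_def B_def assms sum_divide_distrib)
        (intro sum.cong refl, simp add: qbinom_def nz)
  qed
  ultimately have "B = F * A"
    by (simp add: mult.assoc[symmetric])
  then have "fps_nth B n = fps_nth (F * A) n" by simp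
  then have "d n / ?P n = (\<Sum>k=0..n. (- 1) ^ k * (q ^ c) ^ (k choose 2) / ?P k * (a (n - k) / ?P (n - k)))"
    unfolding fps_mult_nth B_def F_def A_def fps_nth_Abs_fps .
  then show ?thesis
    using nz[of n] by (metis nonzero_mult_div_cancel_left times_divide_eq_right)
qed

end

section \<open>Derangement parts\<close>

lemma rank_off_less:
  assumes "x < y" "y \<notin> S" "1 \<le> y"
  shows "rank_off S x < rank_off S y"
proof -
  have "y \<in> {1..y} - S" "y \<notin> {1..x} - S" "{1..x} - S \<subseteq> {1..y} - S"
    using assms by auto
  then show ?thesis
    unfolding rank_off_def by (intro psubset_card_mono) blast+
qed

lemma rank_off_less_iff:
  assumes "x \<in> {1..n} - S" "y \<in> {1..n} - S"
  shows "rank_off S x < rank_off S y \<longleftrightarrow> x < y"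
  using rank_off_less[of x y S] rank_off_less[of y x S] assms by (cases x y rule: linorder_cases) auto

lemma bij_betw_rank_off:
  assumes "S \<subseteq> {1..n}"
  shows "bij_betw (rank_off S) ({1..n} - S) {1..n - card S}"
proof (rule bij_betw_imageI)
  show inj: "inj_on (rank_off S) ({1..n} - S)"
  proof (rule inj_onI)
    fix x y assume "x \<in> {1..n} - S" "y \<in> {1..n} - S" "rank_off S x = rank_off S y"
    then show "x = y"
      using rank_off_less_iff[of x n S y] rank_off_less_iff[of y n S x] by (metis less_irrefl linorder_neqE_nat)
  qed
  have "rank_off S ` ({1..n} - S) \<subseteq> {1..n - card S}"
  proof clarify
    fix x assume x: "x \<in> {1..n}" "x \<notin> S"
    then have "rank_off S x > rank_off S 0" by (intro rank_off_less) auto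
    moreover have "rank_off S x \<le> rank_off S n"
      unfolding rank_off_def using x by (intro card_mono) auto
    ultimately show "rank_off S x \<in> {1..n - card S}"
      using rank_off_subset[OF assms] by auto
  qed
  moreover have "card (rank_off S ` ({1..n} - S)) = card {1..n - card S}"
    using assms by (subst card_image[OF inj]) (simp add: card_Diff_subset finite_subset)
  ultimately show "rank_off S ` ({1..n} - S) = {1..n - card S}"
    by (intro card_subset_eq) auto
qed

definition unrank_off :: "nat \<Rightarrow> nat set \<Rightarrow> nat \<Rightarrow> nat" where
  "unrank_off n S = inv_into ({1..n} - S) (rank_off S)"

text \<open>Positions and letters are relabelled by the same increasing map, so \<open>p j\<close>
  and \<open>j\<close> compare as before. \<open>map_permutation\<close> is the identity off the
  relabelled set, which makes the elements of \<open>S\<close> fixed.\<close>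

definition insert_fixed_points :: "nat \<Rightarrow> nat set \<Rightarrow> cperm \<Rightarrow> cperm" where
  "insert_fixed_points n S = (\<lambda>(p, \<tau>). (map_permutation {1..n - card S} (unrank_off n S) p,
     \<lambda>i\<in>{1..n}. if i \<in> S then 0 else \<tau> (rank_off S i)))"

definition delete_fixed_points :: "nat \<Rightarrow> nat set \<Rightarrow> cperm \<Rightarrow> cperm" where
  "delete_fixed_points n S = (\<lambda>(p, \<tau>). (map_permutation ({1..n} - S) (rank_off S) p,
     \<lambda>j\<in>{1..n - card S}. \<tau> (unrank_off n S j)))"

lemma derangementsD:
  assumes "(p, \<tau>) \<in> derangements c m"
  shows "p permutes {1..m}" "\<tau> \<in> {1..m} \<rightarrow>\<^sub>E {..<c}" "\<And>j. j \<in> {1..m} \<Longrightarrow> p j = j \<Longrightarrow> \<tau> j \<noteq> 0"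
  using assms by (auto simp: derangements_def colored_perms_def fixed_points_def)

context
  fixes n :: nat and S :: "nat set"
  assumes S: "S \<subseteq> {1..n}"
begin

lemma unrank_rank: "i \<in> {1..n} - S \<Longrightarrow> unrank_off n S (rank_off S i) = i"
  unfolding unrank_off_def by (rule bij_betw_inv_into_left[OF bij_betw_rank_off[OF S]])

lemma rank_unrank: "j \<in> {1..n - card S} \<Longrightarrow> rank_off S (unrank_off n S j) = j"
  unfolding unrank_off_def by (rule bij_betw_inv_into_right[OF bij_betw_rank_off[OF S]])

lemma bij_betw_unrank_off: "bij_betw (unrank_off n S) {1..n - card S} ({1..n} - S)"
  unfolding unrank_off_def by (rule bij_betw_inv_into[OF bij_betw_rank_off[OF S]])

lemma rank_in: "i \<in> {1..n} - S \<Longrightarrow> rank_off S i \<in> {1..n - card S}"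
  using bij_betw_rank_off[OF S] by (auto simp: bij_betw_def)

lemma unrank_in: "j \<in> {1..n - card S} \<Longrightarrow> unrank_off n S j \<in> {1..n} - S"
  using bij_betw_unrank_off by (auto simp: bij_betw_def)

lemma insert_fixed_points_moved:
  assumes "i \<in> {1..n} - S"
  shows "fst (insert_fixed_points n S (p, \<tau>)) i = unrank_off n S (p (rank_off S i))"
    and "snd (insert_fixed_points n S (p, \<tau>)) i = \<tau> (rank_off S i)"
proof -
  have "map_permutation {1..n - card S} (unrank_off n S) p (unrank_off n S (rank_off S i)) =
      unrank_off n S (p (rank_off S i))"
    using bij_betw_unrank_off rank_in[OF assms] by (intro map_permutation_apply) (auto simp: bij_betw_def)
  then show "fst (insert_fixed_points n S (p, \<tau>)) i = unrank_off n S (p (rank_off S i))"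
    by (simp only: insert_fixed_points_def prod.case fst_conv unrank_rank[OF assms])
  show "snd (insert_fixed_points n S (p, \<tau>)) i = \<tau> (rank_off S i)"
    using assms by (simp add: insert_fixed_points_def)
qed

lemma insert_fixed_points_permutes:
  assumes "p permutes {1..n - card S}"
  shows "fst (insert_fixed_points n S (p, \<tau>)) permutes ({1..n} - S)"
  using map_permutation_permutes[OF bij_betw_unrank_off assms] by (simp only: insert_fixed_points_def prod.case fst_conv)

lemma insert_fixed_points_fixed:
  assumes "p permutes {1..n - card S}" "i \<in> S"
  shows "fst (insert_fixed_points n S (p, \<tau>)) i = i" "snd (insert_fixed_points n S (p, \<tau>)) i = 0"
proof -
  show "fst (insert_fixed_points n S (p, \<tau>)) i = i"
    using permutes_not_in[OF insert_fixed_points_permutes[OF assms(1)], of i] assms(2) by blast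
  show "snd (insert_fixed_points n S (p, \<tau>)) i = 0"
    using assms(2) S by (auto simp: insert_fixed_points_def)
qed

lemma delete_fixed_points_apply:
  assumes "j \<in> {1..n - card S}"
  shows "fst (delete_fixed_points n S (p, \<tau>)) j = rank_off S (p (unrank_off n S j))"
    and "snd (delete_fixed_points n S (p, \<tau>)) j = \<tau> (unrank_off n S j)"
proof -
  have "map_permutation ({1..n} - S) (rank_off S) p (rank_off S (unrank_off n S j)) =
      rank_off S (p (unrank_off n S j))"
    using bij_betw_rank_off[OF S] unrank_in[OF assms] by (intro map_permutation_apply) (auto simp: bij_betw_def)
  then show "fst (delete_fixed_points n S (p, \<tau>)) j = rank_off S (p (unrank_off n S j))"
    by (simp only: delete_fixed_points_def prod.case fst_conv rank_unrank[OF assms])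
  show "snd (delete_fixed_points n S (p, \<tau>)) j = \<tau> (unrank_off n S j)"
    using assms by (simp add: delete_fixed_points_def)
qed

text \<open>Relabelling is injective, so no fixed point arises outside \<open>S\<close>, and none is
  left after deletion. The condition \<open>c > 0\<close> makes color 0 available for the inserted
  letters.\<close>

lemma bij_betw_insert_fixed_points:
  assumes "c > 0"
  shows "bij_betw (insert_fixed_points n S) (derangements c (n - card S))
    {x \<in> colored_perms c n. fixed_points n x = S}"
proof (rule bij_betw_byWitness[where f' = "delete_fixed_points n S"])
  let ?m = "n - card S"
  show "\<forall>x\<in>derangements c ?m. delete_fixed_points n S (insert_fixed_points n S x) = x"
  proof clarify
    fix p \<tau> assume "(p, \<tau>) \<in> derangements c ?m"
    note x = derangementsD[OF this]
    have "map_permutation ({1..n} - S) (rank_off S) (map_permutation {1..?m} (unrank_off n S) p) = p"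
      by (rule map_permutation_compose_inv[OF bij_betw_unrank_off x(1) rank_unrank])
    moreover have "(\<lambda>j\<in>{1..?m}. (\<lambda>i\<in>{1..n}. if i \<in> S then 0 else \<tau> (rank_off S i)) (unrank_off n S j)) = \<tau>"
    proof
      fix j
      show "(\<lambda>j\<in>{1..?m}. (\<lambda>i\<in>{1..n}. if i \<in> S then 0 else \<tau> (rank_off S i)) (unrank_off n S j)) j = \<tau> j"
        using unrank_in[of j] rank_unrank[of j] PiE_arb[OF x(2), of j]
        by (cases "j \<in> {1..?m}") auto
    qed
    ultimately show "delete_fixed_points n S (insert_fixed_points n S (p, \<tau>)) = (p, \<tau>)"
      by (simp only: delete_fixed_points_def insert_fixed_points_def prod.case)
  qed
  have fixed: "p permutes {1..n} - S" "\<And>i. i \<in> S \<Longrightarrow> \<tau> i = 0" "\<tau> \<in> {1..n} \<rightarrow>\<^sub>E {..<c}"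
    "\<And>i. i \<in> {1..n} - S \<Longrightarrow> p i = i \<Longrightarrow> \<tau> i \<noteq> 0"
    if "(p, \<tau>) \<in> colored_perms c n" "fixed_points n (p, \<tau>) = S" for p \<tau>
  proof -
    have "p permutes {1..n}" using that by (simp add: colored_perms_def)
    moreover have "p i = i" if "i \<in> S" for i
      using that \<open>fixed_points n (p, \<tau>) = S\<close> by (auto simp: fixed_points_def)
    ultimately show "p permutes {1..n} - S"
      by (rule permutes_superset[of p "{1..n}"]) blast
    show "\<tau> i = 0" if "i \<in> S" for i
      using that \<open>fixed_points n (p, \<tau>) = S\<close> by (auto simp: fixed_points_def)
    show "\<tau> \<in> {1..n} \<rightarrow>\<^sub>E {..<c}"
      using that by (simp add: colored_perms_def)
    show "\<tau> i \<noteq> 0" if "i \<in> {1..n} - S" "p i = i" for i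
      using that \<open>fixed_points n (p, \<tau>) = S\<close> by (auto simp: fixed_points_def)
  qed
  show "\<forall>x\<in>{x \<in> colored_perms c n. fixed_points n x = S}.
      insert_fixed_points n S (delete_fixed_points n S x) = x"
  proof (intro ballI)
    fix x assume "x \<in> {x \<in> colored_perms c n. fixed_points n x = S}"
    moreover obtain p \<tau> where x: "x = (p, \<tau>)" by (cases x)
    ultimately have "(p, \<tau>) \<in> colored_perms c n" "fixed_points n (p, \<tau>) = S" by auto
    note f = fixed[OF this]
    have "map_permutation {1..?m} (unrank_off n S) (map_permutation ({1..n} - S) (rank_off S) p) = p"
      by (rule map_permutation_compose_inv[OF bij_betw_rank_off[OF S] f(1) unrank_rank])
    moreover have "(\<lambda>i\<in>{1..n}. if i \<in> S then 0 else (\<lambda>j\<in>{1..?m}. \<tau> (unrank_off n S j)) (rank_off S i)) = \<tau>"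
    proof
      fix i
      show "(\<lambda>i\<in>{1..n}. if i \<in> S then 0 else (\<lambda>j\<in>{1..?m}. \<tau> (unrank_off n S j)) (rank_off S i)) i = \<tau> i"
        using rank_in[of i] unrank_rank[of i] PiE_arb[OF f(3), of i] f(2)[of i]
        by (cases "i \<in> {1..n}") auto
    qed
    ultimately show "insert_fixed_points n S (delete_fixed_points n S x) = x"
      by (simp only: x delete_fixed_points_def insert_fixed_points_def prod.case)
  qed
  show "insert_fixed_points n S ` derangements c ?m \<subseteq> {x \<in> colored_perms c n. fixed_points n x = S}"
  proof (intro image_subsetI)
    fix x assume *: "x \<in> derangements c ?m"
    obtain p \<tau> where x: "x = (p, \<tau>)" by (cases x)
    note d = derangementsD[OF *[unfolded x]]
    obtain p' \<tau>' where x': "insert_fixed_points n S (p, \<tau>) = (p', \<tau>')" by fastforce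
    have p': "p' permutes {1..n}"
      using permutes_subset[OF insert_fixed_points_permutes[OF d(1), of \<tau>]] x' by auto
    have "\<tau>' i < c" if "i \<in> {1..n}" for i
      using insert_fixed_points_moved(2)[of i p \<tau>] insert_fixed_points_fixed(2)[OF d(1), of i \<tau>]
        PiE_mem[OF d(2) rank_in[of i]] that assms x' by (cases "i \<in> S") auto
    moreover have "\<tau>' i = undefined" if "i \<notin> {1..n}" for i
      using x' that by (auto simp: insert_fixed_points_def)
    ultimately have "\<tau>' \<in> {1..n} \<rightarrow>\<^sub>E {..<c}"
      by (intro PiE_I) auto
    moreover have "p' i = i \<and> \<tau>' i = 0 \<longleftrightarrow> i \<in> S" if i: "i \<in> {1..n}" for i
    proof (cases "i \<in> S")
      case True
      then show ?thesis using insert_fixed_points_fixed[OF d(1), of i \<tau>] x' by simp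
    next
      case False
      then have r: "rank_off S i \<in> {1..?m}" and i': "i \<in> {1..n} - S" using rank_in i by auto
      have "p (rank_off S i) \<in> {1..?m}" using permutes_in_image[OF d(1)] r by simp
      then have "p (rank_off S i) = rank_off S i" if "p' i = i"
        using insert_fixed_points_moved(1)[OF i', of p \<tau>] x' that by (metis fst_conv rank_unrank)
      then show ?thesis
        using d(3)[OF r] insert_fixed_points_moved(2)[OF i', of p \<tau>] x' False by auto
    qed
    then have "fixed_points n (p', \<tau>') = S"
      unfolding fixed_points_def prod.case using S by blast
    ultimately show "insert_fixed_points n S x \<in> {x \<in> colored_perms c n. fixed_points n x = S}"
      using p' by (simp add: x x' colored_perms_def)
  qed
  show "delete_fixed_points n S ` {x \<in> colored_perms c n. fixed_points n x = S} \<subseteq> derangements c ?m"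
  proof (intro image_subsetI)
    fix x assume "x \<in> {x \<in> colored_perms c n. fixed_points n x = S}"
    moreover obtain p \<tau> where x: "x = (p, \<tau>)" by (cases x)
    ultimately have "(p, \<tau>) \<in> colored_perms c n" "fixed_points n (p, \<tau>) = S" by auto
    note f = fixed[OF this]
    obtain p' \<tau>' where x': "delete_fixed_points n S (p, \<tau>) = (p', \<tau>')" by fastforce
    have "p' permutes {1..?m}"
      using map_permutation_permutes[OF bij_betw_rank_off[OF S] f(1)] x'
      by (simp add: delete_fixed_points_def)
    moreover have "\<tau>' \<in> {1..?m} \<rightarrow>\<^sub>E {..<c}"
      using x' PiE_mem[OF f(3)] unrank_in by (auto simp: delete_fixed_points_def intro!: PiE_I)
    moreover have "\<not> (p' j = j \<and> \<tau>' j = 0)" if j: "j \<in> {1..?m}" for j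
    proof
      let ?i = "unrank_off n S j"
      assume *: "p' j = j \<and> \<tau>' j = 0"
      have i: "?i \<in> {1..n} - S" using unrank_in j by blast
      have "p ?i \<in> {1..n} - S" using permutes_in_image[OF f(1)] i by blast
      then have "p ?i = ?i"
        using * delete_fixed_points_apply(1)[OF j, of p \<tau>] x' unrank_rank[of "p ?i"] by auto
      then show False
        using f(4)[OF i] * delete_fixed_points_apply(2)[OF j, of p \<tau>] x' by auto
    qed
    ultimately show "delete_fixed_points n S x \<in> derangements c ?m"
      by (auto simp: x x' derangements_def colored_perms_def fixed_points_def)
  qed
qed

section \<open>Statistics under insertion of fixed points\<close>

lemma col_insert_fixed_points: "col n (insert_fixed_points n S (p, \<tau>)) = col (n - card S) (p, \<tau>)"
proof -
  have "col n (insert_fixed_points n S (p, \<tau>)) = (\<Sum>i\<in>{1..n}. if i \<in> S then 0 else \<tau> (rank_off S i))"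
    by (simp add: col_def insert_fixed_points_def)
  also have "\<dots> = (\<Sum>i\<in>{1..n} - S. \<tau> (rank_off S i))"
    by (rule sum.mono_neutral_cong_right) auto
  also have "\<dots> = (\<Sum>j\<in>{1..n - card S}. \<tau> j)"
    by (rule sum.reindex_bij_betw[OF bij_betw_rank_off[OF S]])
  finally show ?thesis by (simp add: col_def)
qed

text \<open>Relabelling and adding fixed points keeps the sign of a permutation; the inversion
  number itself may change.\<close>

lemma inv_count_insert_fixed_points:
  assumes "p permutes {1..n - card S}"
  shows "even (inv_count n (fst (insert_fixed_points n S (p, \<tau>)))) \<longleftrightarrow> even (inv_count (n - card S) p)"
proof -
  let ?p = "fst (insert_fixed_points n S (p, \<tau>))"
  have "?p permutes {1..n}"
    using permutes_subset[OF insert_fixed_points_permutes[OF assms]] by blast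
  then have "(- 1) ^ inv_count n ?p = sign ?p"
    by (simp only: sign_eq_inv_count)
  also have "\<dots> = sign p"
    using bij_betw_unrank_off assms unfolding insert_fixed_points_def
    by (simp only: prod.case fst_conv, intro sign_map_permutation) (auto simp: bij_betw_def)
  also have "\<dots> = (- 1) ^ inv_count (n - card S) p"
    by (rule sign_eq_inv_count[OF assms])
  finally show ?thesis
    by (simp add: minus_one_power_iff split: if_splits)
qed

text \<open>The low letters are the colored and the subcedant ones. The value of an adjacent fixed
  point is already taken, so comparing a letter with it amounts to comparing the letter with its own
  position, and relabelling preserves that comparison.\<close>

lemma maj_insert_fixed_points:
  assumes "(p, \<tau>) \<in> derangements c (n - card S)"
  shows "maj n (insert_fixed_points n S (p, \<tau>)) =
    shuffle_maj (\<lambda>j. \<tau> j > 0 \<or> p j < j) (\<lambda>j. j \<in> Des (n - card S) (p, \<tau>)) n S"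
proof -
  let ?m = "n - card S"
  let ?Lo = "\<lambda>j. \<tau> j > 0 \<or> p j < j" and ?D = "\<lambda>j. j \<in> Des ?m (p, \<tau>)"
  note d = derangementsD[OF assms]
  obtain p' \<tau>' where x': "insert_fixed_points n S (p, \<tau>) = (p', \<tau>')" by fastforce
  have p'_off: "p' i \<in> {1..n} - S \<longleftrightarrow> i \<in> {1..n} - S" for i
    using permutes_in_image[OF insert_fixed_points_permutes[OF d(1), of \<tau>], of i] x' by simp
  have p_in: "p (rank_off S i) \<in> {1..?m}" if "i \<in> {1..n} - S" for i
    using permutes_in_image[OF d(1)] rank_in[OF that] by blast
  have rank_p': "rank_off S (p' i) = p (rank_off S i)" if "i \<in> {1..n} - S" for i
    using insert_fixed_points_moved(1)[OF that, of p \<tau>] x' rank_unrank[OF p_in[OF that]] by simp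
  have \<tau>': "\<tau>' i = \<tau> (rank_off S i)" if "i \<in> {1..n} - S" for i
    using insert_fixed_points_moved(2)[OF that, of p \<tau>] x' by simp
  have fixed: "p' i = i" "\<tau>' i = 0" if "i \<in> S" for i
    using insert_fixed_points_fixed[OF d(1) that, of \<tau>] x' by auto
  have p'_less: "p' i < j \<longleftrightarrow> p (rank_off S i) < rank_off S j" "j < p' i \<longleftrightarrow> rank_off S j < p (rank_off S i)"
    if "i \<in> {1..n} - S" "j \<in> {1..n} - S" for i j
    using rank_off_less_iff[of "p' i" n S j] rank_off_less_iff[of j n S "p' i"] p'_off[of i] rank_p'[of i] that
    by auto
  have "i \<in> Des n (p', \<tau>') \<longleftrightarrow> shuffle_desc ?Lo ?D S i" if i: "i \<in> {1..<n}" for i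
  proof -
    have Des: "i \<in> Des n (p', \<tau>') \<longleftrightarrow> letter_less (p' (Suc i), \<tau>' (Suc i)) (p' i, \<tau>' i)"
      using i by (simp add: Des_def)
    consider "i \<in> S" "Suc i \<in> S" | "i \<in> S" "Suc i \<notin> S" | "i \<notin> S" "Suc i \<in> S" | "i \<notin> S" "Suc i \<notin> S"
      by blast
    then show ?thesis
    proof cases
      case 1
      then show ?thesis
        unfolding Des by (simp add: fixed letter_less_def shuffle_desc_def)
    next
      case 2
      then have s: "Suc i \<in> {1..n} - S" using i by auto
      \<comment> \<open>The letter \<open>i\<close> belongs to the fixed point, so the threshold can
        move from \<open>i\<close> to \<open>Suc i\<close>.\<close>
      have "p' (Suc i) \<noteq> i" using p'_off[of "Suc i"] s 2 by auto
      then have "p' (Suc i) < i \<longleftrightarrow> p' (Suc i) < Suc i" by auto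
      then show ?thesis
        unfolding Des using 2 p'_less(1)[OF s s] \<tau>'[OF s]
        by (auto simp: fixed letter_less_def shuffle_desc_def)
    next
      case 3
      then have s: "i \<in> {1..n} - S" using i by auto
      \<comment> \<open>Here the letter \<open>Suc i\<close> is taken. Below, \<open>d(3)\<close>
        makes every letter that is not low an uncolored excedant.\<close>
      have "p' i \<noteq> Suc i" using p'_off[of i] s 3 by auto
      then have "Suc i < p' i \<longleftrightarrow> i < p' i" by auto
      then show ?thesis
        unfolding Des using 3 p'_less(2)[OF s s] \<tau>'[OF s] d(3)[OF rank_in[OF s]]
        by (auto simp: fixed letter_less_def shuffle_desc_def)
    next
      case 4
      then have s: "i \<in> {1..n} - S" and t: "Suc i \<in> {1..n} - S" using i by auto
      \<comment> \<open>Positions adjacent here stay adjacent after deletion, so \<open>D\<close>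
        applies.\<close>
      have r: "rank_off S (Suc i) = Suc (rank_off S i)" using 4 by (simp add: rank_off_Suc)
      have "p' (Suc i) < p' i \<longleftrightarrow> p (rank_off S (Suc i)) < p (rank_off S i)"
        using p'_less(1)[OF t, of "p' i"] p'_off[of i] s rank_p'[OF s] by auto
      moreover have "1 \<le> rank_off S i" "rank_off S i < ?m"
        using rank_in[OF s] rank_in[OF t] r by auto
      ultimately show ?thesis
        unfolding Des using 4 \<tau>'[OF s] \<tau>'[OF t] r
        by (auto simp: letter_less_def shuffle_desc_def Des_def)
    qed
  qed
  moreover have "Des n (p', \<tau>') = {i \<in> {1..<n}. i \<in> Des n (p', \<tau>')}"
    by (auto simp: Des_def)
  ultimately have "Des n (p', \<tau>') = {i \<in> {1..<n}. shuffle_desc ?Lo ?D S i}"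
    by blast
  then show ?thesis
    unfolding x' maj_def shuffle_maj_def by (simp only: sum.inter_filter finite_atLeastLessThan)
qed

text \<open>\<open>S\<close> enters only through its size and the last factor, so summing over the
  sets of a given size gives a shuffle sum.\<close>

lemma signed_weight_insert_fixed_points:
  assumes "(p, \<tau>) \<in> derangements c (n - card S)"
  shows "signed_weight c n q (insert_fixed_points n S (p, \<tau>)) =
    (- 1) ^ (col (n - card S) (p, \<tau>) + inv_count (n - card S) p) * q ^ col (n - card S) (p, \<tau>) *
    (q ^ c) ^ shuffle_maj (\<lambda>j. \<tau> j > 0 \<or> p j < j) (\<lambda>j. j \<in> Des (n - card S) (p, \<tau>)) n S"
proof -
  have "(- 1 :: 'a) ^ (col n (insert_fixed_points n S (p, \<tau>)) +
        inv_count n (fst (insert_fixed_points n S (p, \<tau>)))) =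
      (- 1) ^ (col (n - card S) (p, \<tau>) + inv_count (n - card S) p)"
    using inv_count_insert_fixed_points[OF derangementsD(1)[OF assms], of \<tau>]
    by (simp add: minus_one_power_iff col_insert_fixed_points)
  then show ?thesis
    unfolding signed_weight_def fmaj_def maj_insert_fixed_points[OF assms] col_insert_fixed_points
    by (simp add: power_add power_mult mult_ac)
qed

end

text \<open>These are the hypotheses of \<open>shuffle_maj_sum\<close>. An uncolored excedant at
  \<open>j\<close> is at least \<open>Suc j\<close>, an uncolored subcedant at \<open>Suc j\<close>
  is at most \<open>j\<close>, and colored letters lie below uncolored ones. With the types
  exchanged, the same bounds give an ascent.\<close>

lemma derangement_letter_types:
  assumes "(p, \<tau>) \<in> derangements c m" "1 \<le> j" "j < m"
  shows "\<not> (\<tau> j > 0 \<or> p j < j) \<Longrightarrow> \<tau> (Suc j) > 0 \<or> p (Suc j) < Suc j \<Longrightarrow> j \<in> Des m (p, \<tau>)"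
    and "\<tau> j > 0 \<or> p j < j \<Longrightarrow> \<not> (\<tau> (Suc j) > 0 \<or> p (Suc j) < Suc j) \<Longrightarrow> j \<notin> Des m (p, \<tau>)"
proof -
  have "\<tau> i > 0 \<or> p i < i \<or> i < p i" if "i \<in> {1..m}" for i
    using derangementsD(3)[OF assms(1) that] by force
  from this[of j] this[of "Suc j"] have "\<tau> j > 0 \<or> p j < j \<or> j < p j"
    "\<tau> (Suc j) > 0 \<or> p (Suc j) < Suc j \<or> Suc j < p (Suc j)"
    using assms(2,3) by auto
  then show "\<not> (\<tau> j > 0 \<or> p j < j) \<Longrightarrow> \<tau> (Suc j) > 0 \<or> p (Suc j) < Suc j \<Longrightarrow> j \<in> Des m (p, \<tau>)"
    and "\<tau> j > 0 \<or> p j < j \<Longrightarrow> \<not> (\<tau> (Suc j) > 0 \<or> p (Suc j) < Suc j) \<Longrightarrow> j \<notin> Des m (p, \<tau>)"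
    using assms(2,3) by (auto simp: Des_def letter_less_def)
qed

section \<open>The convolution over fixed-point sets\<close>

definition signed_derangement_sum :: "nat \<Rightarrow> nat \<Rightarrow> 'a::comm_ring_1 \<Rightarrow> 'a" where
  "signed_derangement_sum c n q = (\<Sum>x\<in>derangements c n. signed_weight c n q x)"

theorem signed_sum_by_fixed_points:
  fixes q :: "'a::field"
  assumes qint_nz: "\<forall>i\<ge>1. qint (i * c) q \<noteq> 0" and "c > 0"
  shows "(\<Sum>x\<in>colored_perms c n. signed_weight c n q x) =
    (\<Sum>k=0..n. qbinom c q (n - k) k * signed_derangement_sum c (n - k) q)"
proof -
  \<comment> \<open>\<open>?w\<close> collects the factors that depend on the derangement alone;
    only the power of \<open>q ^ c\<close> varies with \<open>S\<close>.\<close>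
  let ?w = "\<lambda>m (p, \<tau>). (- 1) ^ (col m (p, \<tau>) + inv_count m p) * q ^ col m (p, \<tau>)"
  let ?s = "\<lambda>m (p, \<tau>) S. shuffle_maj (\<lambda>j. \<tau> j > 0 \<or> p j < j) (\<lambda>j. j \<in> Des m (p, \<tau>)) n S"
  have "(\<Sum>x\<in>colored_perms c n. signed_weight c n q x) =
      (\<Sum>S\<in>Pow {1..n}. \<Sum>x\<in>{x \<in> colored_perms c n. fixed_points n x = S}. signed_weight c n q x)"
    by (intro sum.group[symmetric] finite_colored_perms) (auto simp: fixed_points_def)
  also have "\<dots> = (\<Sum>S\<in>Pow {1..n}. \<Sum>x\<in>derangements c (n - card S).
      ?w (n - card S) x * (q ^ c) ^ ?s (n - card S) x S)"
  proof (rule sum.cong[OF refl])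
    fix S assume "S \<in> Pow {1..n}"
    then have S: "S \<subseteq> {1..n}" by simp
    have "(\<Sum>x\<in>{x \<in> colored_perms c n. fixed_points n x = S}. signed_weight c n q x) =
        (\<Sum>x\<in>derangements c (n - card S). signed_weight c n q (insert_fixed_points n S x))"
      by (rule sum.reindex_bij_betw[symmetric, OF bij_betw_insert_fixed_points[OF S \<open>c > 0\<close>]])
    also have "\<dots> = (\<Sum>x\<in>derangements c (n - card S).
        ?w (n - card S) x * (q ^ c) ^ ?s (n - card S) x S)"
      by (intro sum.cong refl) (auto simp: signed_weight_insert_fixed_points[OF S])
    finally show "(\<Sum>x\<in>{x \<in> colored_perms c n. fixed_points n x = S}. signed_weight c n q x) = \<dots>" .
  qed
  \<comment> \<open>Sets of one size share the same derangements, so the two inner sums can then be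
    exchanged.\<close>
  also have "\<dots> = (\<Sum>k=0..n. \<Sum>S\<in>{S \<in> Pow {1..n}. card S = k}. \<Sum>x\<in>derangements c (n - card S).
      ?w (n - card S) x * (q ^ c) ^ ?s (n - card S) x S)"
    using card_mono[of "{1..n}"] by (intro sum.group[symmetric]) auto
  also have "\<dots> = (\<Sum>k=0..n. \<Sum>S\<in>subsets_of_size n k. \<Sum>x\<in>derangements c (n - k).
      ?w (n - k) x * (q ^ c) ^ ?s (n - k) x S)"
    by (intro sum.cong refl) (auto simp: subsets_of_size_def)
  also have "\<dots> = (\<Sum>k=0..n. \<Sum>x\<in>derangements c (n - k). ?w (n - k) x *
      (\<Sum>S\<in>subsets_of_size n k. (q ^ c) ^ ?s (n - k) x S))"
    by (subst sum.swap) (simp only: sum_distrib_left)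
  also have "\<dots> = (\<Sum>k=0..n. \<Sum>x\<in>derangements c (n - k).
      signed_weight c (n - k) q x * qbinom c q (n - k) k)"
  proof (intro sum.cong refl)
    fix k x assume k: "k \<in> {0..n}" and x': "x \<in> derangements c (n - k)"
    obtain p \<tau> where x: "x = (p, \<tau>)" by (cases x)
    have "(\<Sum>S\<in>subsets_of_size (n - k + k) k.
        (q ^ c) ^ shuffle_maj (\<lambda>j. \<tau> j > 0 \<or> p j < j) (\<lambda>j. j \<in> Des (n - k) (p, \<tau>)) (n - k + k) S) =
      (q ^ c) ^ (\<Sum>j\<in>{1..<n - k}. if j \<in> Des (n - k) (p, \<tau>) then j else 0) * qbinom c q (n - k) k"
      using derangement_letter_types[OF x'[unfolded x]]
      by (intro shuffle_maj_sum[OF qint_nz]) blast+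
    moreover have "n - k + k = n" using k by simp
    moreover have "(\<Sum>j\<in>{1..<n - k}. if j \<in> Des (n - k) (p, \<tau>) then j else 0) = maj (n - k) (p, \<tau>)"
    proof -
      have "{j \<in> {1..<n - k}. j \<in> Des (n - k) (p, \<tau>)} = Des (n - k) (p, \<tau>)"
        by (auto simp: Des_def)
      then show ?thesis
        unfolding maj_def by (simp only: finite_atLeastLessThan flip: sum.inter_filter)
    qed
    ultimately show "?w (n - k) x * (\<Sum>S\<in>subsets_of_size n k. (q ^ c) ^ ?s (n - k) x S) =
        signed_weight c (n - k) q x * qbinom c q (n - k) k"
      by (simp add: x signed_weight_def fmaj_def power_add power_mult mult_ac)
  qed
  finally show ?thesis
    by (simp add: signed_derangement_sum_def sum_distrib_left mult.commute)
qed

section \<open>Evaluation at the indeterminate\<close>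

lemma qint_minus:
  fixes q :: "'a::field"
  assumes "even m" "1 + q \<noteq> 0"
  shows "qint m (- q) = qint m q * ((1 - q) / (1 + q))"
proof -
  have "(1 - r) * qint m r = 1 - r ^ m" for r :: 'a
    unfolding qint_def by (rule one_diff_power_eq[symmetric])
  \<comment> \<open>For even \<open>m\<close> the right-hand sides at \<open>q\<close> and
    \<open>- q\<close> coincide.\<close>
  from this[of "- q"] this[of q] have "(1 + q) * qint m (- q) = (1 - q) * qint m q"
    using assms(1) by simp
  then show ?thesis
    using assms(2) by (simp add: field_simps)
qed

text \<open>Each odd \<open>i\<close> contributes one quotient by \<open>qint_minus\<close>, as
  \<open>i * c\<close> is even; there are \<open>(n + 1) div 2\<close> odd indices up to
  \<open>n\<close>.\<close>

lemma signed_mahonian_product: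
  fixes q :: "'a::field"
  assumes "even c" "1 + q \<noteq> 0"
  shows "(\<Prod>i=1..n. qint (i * c) (alt_var i q)) = qprod c n q * ((1 - q) / (1 + q)) ^ ((n + 1) div 2)"
proof (induction n)
  case 0
  then show ?case by (simp add: qprod_0)
next
  case (Suc n)
  then show ?case
    using qint_minus[of "Suc n * c" q] assms
    by (cases "even n") (simp_all add: qprod_Suc mult_ac del: mult_Suc)
qed

lemma signed_derangement_poly_eq:
  assumes "even c"
  shows "signed_derangement_poly c n q = signed_derangement_sum c n q"
proof -
  have "(- 1 :: 'a) ^ clength c n x = (- 1) ^ (col n x + inv_count n (fst x))" for x
    using assms by (cases x) (simp add: clength_def minus_one_power_iff)
  then show ?thesis
    by (simp add: signed_derangement_poly_def signed_derangement_sum_def signed_weight_def)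
qed

lemma to_fract_power: "to_fract (x ^ n) = to_fract x ^ n"
  by (induction n) simp_all

lemma qint_qvar_nz: "m > 0 \<Longrightarrow> qint m qvar \<noteq> 0"
proof -
  assume "m > 0"
  have "qint m qvar = to_fract (\<Sum>i<m. monom 1 i :: int poly)"
    unfolding qint_def qvar_def to_fract_sum by (simp add: monom_altdef to_fract_power)
  \<comment> \<open>A nonzero constant coefficient rules out the zero polynomial.\<close>
  moreover have "coeff (\<Sum>i<m. monom 1 i :: int poly) 0 = 1"
    using \<open>m > 0\<close> by (simp add: coeff_sum)
  ultimately show ?thesis
    by (metis coeff_0 to_fract_eq_0_iff zero_neq_one)
qed

theorem theorem2p12:
  fixes c n :: nat
  assumes "even c" and "c > 0" and "n \<ge> 1"
  shows "signed_derangement_poly c n qvar =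
    qprod c n qvar *
      (\<Sum>k=0..n. (- 1) ^ k * qvar ^ (c * (k choose 2)) / qprod c k qvar *
         ((1 - qvar) / (1 + qvar)) ^ ((n - k + 1) div 2))"
proof -
  have nz: "\<forall>i\<ge>1. qint (i * c) qvar \<noteq> 0"
    using \<open>c > 0\<close> by (auto intro!: qint_qvar_nz)
  \<comment> \<open>This sum is \<open>qint 2 qvar\<close>.\<close>
  have "1 + qvar \<noteq> 0"
    using qint_qvar_nz[of 2] by (simp add: qint_def numeral_2_eq_2)
  note A = signed_mahonian[OF \<open>even c\<close>, where q = qvar, unfolded signed_mahonian_product[OF \<open>even c\<close> this]]
  \<comment> \<open>The total for \<open>n - k\<close> contains the factor
    \<open>qprod c (n - k) qvar\<close>, which cancels the denominator from the inversion and leaves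
    the power.\<close>
  have "signed_derangement_sum c n qvar = qprod c n qvar *
      (\<Sum>k=0..n. (- 1) ^ k * (qvar ^ c) ^ (k choose 2) / qprod c k qvar *
        (qprod c (n - k) qvar * ((1 - qvar) / (1 + qvar)) ^ ((n - k + 1) div 2) / qprod c (n - k) qvar))"
    using signed_sum_by_fixed_points[OF nz \<open>c > 0\<close>]
    by (intro qbinom_inversion[OF nz]) (simp_all add: A)
  then show ?thesis
    by (simp add: signed_derangement_poly_eq[OF \<open>even c\<close>] qprod_nz[OF nz] power_mult)
qed

end
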